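(* Let $(X,d)$ be a polyhedral metric surface. If $(X,d)$ is $K$-bi-Lipschitz homeomorphic to a Riemannian manifold, then the cone angle at every vertex of $X$ is between $2\pi K^{-2}$ and $2\pi K^{2}$.
   Context: A polyhedral manifold is a simplicial complex in which the link of every simplex is a sphere. A polyhedral metric manifold $(X,d)$ is a polyhedral manifold $X$ together with a path (length) metric $d$ such that each simplex is isometric to a Euclidean simplex. A polyhedral metric surface is a polyhedral metric manifold of dimension 2. For $\alpha>0$, let $g_\alpha$ denote the metric on $\mathbb{R}^2$ defined in polar coordinates by $g_\alpha = \left(\frac{\alpha r}{2\pi}\right)^2 d\theta^2 + dr^2$ (for $\alpha = 2\pi$ this is the Euclidean metric). A cone is a metric space isometric to a disk around $0$ in $(\mathbb{R}^2, g_\alpha)$; the point $0$ is called the tip and $\alpha$ the cone angle. Each vertex $v$ of a polyhedral metric surface has a neighborhood isometric to a cone with tip $v$, and the cone angle at $v$ is the cone angle of this cone (equivalently, the sum of the angles at $v$ of the triangles containing $v$). A homeomorphism $f$ between metric spaces is $K$-bi-Lipschitz (where $K \geq 1$) if both $f$ and $f^{-1}$ are $K$-Lipschitz. A Riemannian manifold is regarded as a metric space with its Riemannian distance. *)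

theory Defs
  imports "HOL-Analysis.Analysis"
begin

section \<open>Simplicial complexes and polyhedral manifolds\<close>

text \<open>
  The complexes are abstract and may be infinite (\<open>simplicial_complex\<close> of the library is finite and
  linearly embedded in a Euclidean space). A point of the realization is given by its barycentric
  coordinates, and the realization carries the weak topology.
\<close>

definition abstract_complex :: "'v set set \<Rightarrow> bool" where
  "abstract_complex C \<longleftrightarrow>
     (\<forall>s\<in>C. finite s \<and> s \<noteq> {}) \<and> (\<forall>s\<in>C. \<forall>t. t \<subseteq> s \<and> t \<noteq> {} \<longrightarrow> t \<in> C)"

definition link :: "'v set set \<Rightarrow> 'v set \<Rightarrow> 'v set set" where
  "link C s = {t. t \<noteq> {} \<and> t \<inter> s = {} \<and> t \<union> s \<in> C}"

definition cell :: "'v set \<Rightarrow> ('v \<Rightarrow> real) set" where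
  "cell s = {x. (\<forall>v. 0 \<le> x v) \<and> (\<forall>v. v \<notin> s \<longrightarrow> x v = 0) \<and> (\<Sum>v\<in>s. x v) = 1}"

definition vertex_point :: "'v \<Rightarrow> 'v \<Rightarrow> real" where
  "vertex_point v = (\<lambda>w. if w = v then 1 else 0)"

definition realization :: "'v set set \<Rightarrow> ('v \<Rightarrow> real) set" where
  "realization C = (\<Union>s\<in>C. cell s)"

definition weak_open :: "'v set set \<Rightarrow> ('v \<Rightarrow> real) set \<Rightarrow> bool" where
  "weak_open C U \<longleftrightarrow> U \<subseteq> realization C \<and>
     (\<forall>s\<in>C. openin (subtopology (powertop_real UNIV) (cell s)) (U \<inter> cell s))"

definition realization_topology :: "'v set set \<Rightarrow> ('v \<Rightarrow> real) topology" where
  "realization_topology C = topology (weak_open C)"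

lemma istopology_weak_open: "istopology (weak_open C)"
  unfolding istopology_def
proof (intro conjI allI impI)
  fix S T
  assume "weak_open C S" "weak_open C T"
  have "openin (subtopology (powertop_real UNIV) (cell s)) (S \<inter> T \<inter> cell s)" if "s \<in> C" for s
  proof -
    have "openin (subtopology (powertop_real UNIV) (cell s)) ((S \<inter> cell s) \<inter> (T \<inter> cell s))"
      by (rule openin_Int) (use \<open>weak_open C S\<close> \<open>weak_open C T\<close> that in \<open>simp_all add: weak_open_def\<close>)
    moreover have "(S \<inter> cell s) \<inter> (T \<inter> cell s) = S \<inter> T \<inter> cell s"
      by blast
    ultimately show ?thesis
      by simp
  qed
  then show "weak_open C (S \<inter> T)"
    using \<open>weak_open C S\<close> by (auto simp: weak_open_def)
next
  fix \<K> assume K: "\<forall>U\<in>\<K>. weak_open C U"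
  have "openin (subtopology (powertop_real UNIV) (cell s)) (\<Union>U\<in>\<K>. U \<inter> cell s)" if "s \<in> C" for s
    by (rule openin_Union) (use K that in \<open>auto simp: weak_open_def\<close>)
  then show "weak_open C (\<Union>\<K>)"
    using K unfolding weak_open_def Int_Union2 by blast
qed

lemma openin_realization_topology: "openin (realization_topology C) U \<longleftrightarrow> weak_open C U"
  by (simp add: realization_topology_def istopology_weak_open)

text \<open>
  The link of a simplex with \<open>k\<close> vertices has to be a sphere of dimension \<open>n - k\<close>. For \<open>k = n + 1\<close>
  this is the empty sphere, and the bound on \<open>card s\<close> makes the link empty.
\<close>

definition polyhedral_manifold :: "nat \<Rightarrow> 'v set set \<Rightarrow> bool" where
  "polyhedral_manifold n C \<longleftrightarrow> abstract_complex C \<and>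
     (\<forall>s\<in>C. card s \<le> Suc n \<and>
        (card s \<le> n \<longrightarrow> realization_topology (link C s) homeomorphic_space nsphere (n - card s)))"


section \<open>Length metrics and polyhedral metric surfaces\<close>

definition curve_length :: "('a \<Rightarrow> 'a \<Rightarrow> real) \<Rightarrow> (real \<Rightarrow> 'a) \<Rightarrow> ennreal" where
  "curve_length d \<gamma> =
     (SUP (n, t) \<in> {(n :: nat, t :: nat \<Rightarrow> real). t 0 = 0 \<and> t n = 1 \<and> mono_on {..n} t}.
        \<Sum>i<n. ennreal (d (\<gamma> (t i)) (\<gamma> (t (Suc i)))))"

text \<open>The length metric induced by \<open>d\<close> on the subset \<open>S\<close>; it is \<open>\<infinity>\<close> if no rectifiable curve in \<open>S\<close>
  joins the two points.\<close>

definition induced_length_dist :: "'a set \<Rightarrow> ('a \<Rightarrow> 'a \<Rightarrow> real) \<Rightarrow> 'a \<Rightarrow> 'a \<Rightarrow> ennreal" where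
  "induced_length_dist S d x y =
     (INF \<gamma> \<in> {\<gamma>. pathin (Metric_space.mtopology S d) \<gamma> \<and> \<gamma> 0 = x \<and> \<gamma> 1 = y}. curve_length d \<gamma>)"

definition length_metric :: "'a set \<Rightarrow> ('a \<Rightarrow> 'a \<Rightarrow> real) \<Rightarrow> bool" where
  "length_metric S d \<longleftrightarrow> Metric_space S d \<and>
     (\<forall>x\<in>S. \<forall>y\<in>S. ennreal (d x y) = induced_length_dist S d x y)"

text \<open>
  The Euclidean plane is the type \<^typ>\<open>complex\<close>. A simplex is compared with a Euclidean simplex through
  its own length metric: the restriction of \<open>d\<close> to it can be smaller, because \<open>d\<close> allows shortcuts
  through neighbouring simplices. The isometry respects faces, but it need not be affine in the
  barycentric coordinates.
\<close>

definition euclidean_simplex :: "(('v \<Rightarrow> real) \<Rightarrow> ('v \<Rightarrow> real) \<Rightarrow> real) \<Rightarrow> 'v set \<Rightarrow> bool" where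
  "euclidean_simplex d s \<longleftrightarrow>
     (\<exists>(P :: 'v \<Rightarrow> complex) h.
        inj_on P s \<and> \<not> affine_dependent (P ` s) \<and>
        (\<forall>t. t \<noteq> {} \<and> t \<subseteq> s \<longrightarrow> h ` cell t = convex hull (P ` t)) \<and>
        (\<forall>x\<in>cell s. \<forall>y\<in>cell s. induced_length_dist (cell s) d x y = ennreal (dist (h x) (h y))))"

definition polyhedral_metric_surface ::
    "'v set set \<Rightarrow> (('v \<Rightarrow> real) \<Rightarrow> ('v \<Rightarrow> real) \<Rightarrow> real) \<Rightarrow> bool" where
  "polyhedral_metric_surface C d \<longleftrightarrow>
     polyhedral_manifold 2 C \<and>
     length_metric (realization C) d \<and>
     Metric_space.mtopology (realization C) d = realization_topology C \<and>
     (\<forall>s\<in>C. euclidean_simplex d s)"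


section \<open>Piecewise smooth curves\<close>

definition C1_on :: "real set \<Rightarrow> (real \<Rightarrow> 'a::real_normed_vector) \<Rightarrow> bool" where
  "C1_on I \<gamma> \<longleftrightarrow>
     (\<exists>D. continuous_on I D \<and> (\<forall>t\<in>I. (\<gamma> has_vector_derivative D t) (at t within I)))"

text \<open>
  One-sided derivatives at the break points are part of the definition, so the speed is bounded.
  The library's \<open>piecewise_C1_differentiable_on\<close> admits curves of infinite length, for which the
  length integral would be the default value \<open>0\<close>.
\<close>

definition piecewise :: "(real set \<Rightarrow> bool) \<Rightarrow> bool" where
  "piecewise Q \<longleftrightarrow> (\<exists>(n :: nat) t. t 0 = 0 \<and> t n = 1 \<and>
     (\<forall>i<n. t i < t (Suc i) \<and> Q {t i..t (Suc i)}))"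


section \<open>Cones and cone angles\<close>

text \<open>
  If \<open>v\<close> is a tangent vector at \<open>p = r e\<^sup>i\<^sup>\<theta> \<noteq> 0\<close> then \<open>v / p = dr(v) / r + \<i> d\<theta>(v)\<close>, so this is the
  norm \<open>sqrt ((\<alpha> r / 2\<pi>)\<^sup>2 d\<theta>\<^sup>2 + dr\<^sup>2)\<close>. At \<open>p = 0\<close> it is \<open>0\<close>, which does not affect lengths: a
  \<open>C\<^sup>1\<close> curve passes through \<open>0\<close> with non-zero velocity only at isolated times.
\<close>

definition cone_norm :: "real \<Rightarrow> complex \<Rightarrow> complex \<Rightarrow> real" where
  "cone_norm \<alpha> p v = sqrt ((\<alpha> * cmod p / (2 * pi))\<^sup>2 * (Im (v / p))\<^sup>2 + (cmod p * Re (v / p))\<^sup>2)"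

definition cone_length :: "real \<Rightarrow> (real \<Rightarrow> complex) \<Rightarrow> real" where
  "cone_length \<alpha> \<gamma> = integral {0..1} (\<lambda>t. cone_norm \<alpha> (\<gamma> t) (vector_derivative \<gamma> (at t)))"

definition cone_dist :: "real \<Rightarrow> complex \<Rightarrow> complex \<Rightarrow> real" where
  "cone_dist \<alpha> p q =
     (INF \<gamma> \<in> {\<gamma>. path \<gamma> \<and> piecewise (\<lambda>I. C1_on I \<gamma>) \<and> \<gamma> 0 = p \<and> \<gamma> 1 = q}. cone_length \<alpha> \<gamma>)"

text \<open>The \<open>g\<^sub>\<alpha>\<close>-disk of radius \<open>r\<close> around the tip is the Euclidean disk \<open>ball 0 r\<close>, because the radial
  part of \<open>g\<^sub>\<alpha>\<close> is \<open>dr\<^sup>2\<close>. The cone angle is a relation, like \<open>has_derivative\<close>: it holds for the angle of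
  every cone with tip \<open>v\<close> that is isometric to a neighbourhood of \<open>v\<close>.\<close>

definition has_cone_angle :: "'a set \<Rightarrow> ('a \<Rightarrow> 'a \<Rightarrow> real) \<Rightarrow> 'a \<Rightarrow> real \<Rightarrow> bool" where
  "has_cone_angle X d v \<alpha> \<longleftrightarrow> \<alpha> > 0 \<and>
     (\<exists>N r h. openin (Metric_space.mtopology X d) N \<and> v \<in> N \<and> r > 0 \<and>
        bij_betw h N (ball 0 r) \<and> h v = 0 \<and>
        (\<forall>x\<in>N. \<forall>y\<in>N. d x y = cone_dist \<alpha> (h x) (h y)))"


section \<open>Riemannian manifolds\<close>

primrec Ck_on :: "nat \<Rightarrow> 'a::real_normed_vector set \<Rightarrow> ('a \<Rightarrow> 'b::real_normed_vector) \<Rightarrow> bool" where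
  "Ck_on 0 S f \<longleftrightarrow> continuous_on S f"
| "Ck_on (Suc k) S f \<longleftrightarrow> (\<forall>x\<in>S. f differentiable (at x)) \<and>
     (\<forall>v. Ck_on k S (\<lambda>x. frechet_derivative f (at x) v))"

definition smooth_on :: "'a::real_normed_vector set \<Rightarrow> ('a \<Rightarrow> 'b::real_normed_vector) \<Rightarrow> bool" where
  "smooth_on S f \<longleftrightarrow> (\<forall>k. Ck_on k S f)"

type_synonym ('m, 'e) chart = "'m set \<times> ('m \<Rightarrow> 'e)"

text \<open>Manifolds are connected, so that the Riemannian distance is finite.\<close>

locale smooth_manifold =
  fixes M :: "'m topology" and A :: "('m, 'e::euclidean_space) chart set"
  assumes Hausdorff: "Hausdorff_space M"
    and second_countable: "second_countable M"
    and connected: "connected_space M"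
    and charts_cover: "\<Union>(fst ` A) = topspace M"
    and chart: "(U, \<phi>) \<in> A \<Longrightarrow> openin M U \<and> open (\<phi> ` U) \<and>
      homeomorphic_map (subtopology M U) (top_of_set (\<phi> ` U)) \<phi>"
    and smooth_transition: "\<lbrakk>(U, \<phi>) \<in> A; (V, \<psi>) \<in> A\<rbrakk> \<Longrightarrow>
      smooth_on (\<phi> ` (U \<inter> V)) (\<psi> \<circ> inv_into U \<phi>)"

text \<open>\<open>g (U, \<phi>) p\<close> is the expression of the metric tensor at \<open>p \<in> U\<close> in the coordinates \<open>\<phi>\<close>.\<close>

locale riemannian_manifold = smooth_manifold M A
  for M :: "'m topology" and A :: "('m, 'e::euclidean_space) chart set" +
  fixes g :: "('m, 'e) chart \<Rightarrow> 'm \<Rightarrow> 'e \<Rightarrow> 'e \<Rightarrow> real"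
  assumes metric_bilinear: "\<lbrakk>(U, \<phi>) \<in> A; p \<in> U\<rbrakk> \<Longrightarrow> bilinear (g (U, \<phi>) p)"
    and metric_sym: "\<lbrakk>(U, \<phi>) \<in> A; p \<in> U\<rbrakk> \<Longrightarrow> g (U, \<phi>) p u v = g (U, \<phi>) p v u"
    and metric_pos: "\<lbrakk>(U, \<phi>) \<in> A; p \<in> U; v \<noteq> 0\<rbrakk> \<Longrightarrow> g (U, \<phi>) p v v > 0"
    and metric_smooth: "(U, \<phi>) \<in> A \<Longrightarrow> smooth_on (\<phi> ` U) (\<lambda>x. g (U, \<phi>) (inv_into U \<phi> x) u v)"
    and metric_tensor: "\<lbrakk>(U, \<phi>) \<in> A; (V, \<psi>) \<in> A; p \<in> U \<inter> V;
      T = frechet_derivative (\<psi> \<circ> inv_into U \<phi>) (at (\<phi> p))\<rbrakk> \<Longrightarrow>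
      g (V, \<psi>) p (T u) (T v) = g (U, \<phi>) p u v"

definition piecewise_C1_curve :: "'m topology \<Rightarrow> ('m, 'e::euclidean_space) chart set \<Rightarrow> (real \<Rightarrow> 'm) \<Rightarrow> bool"
  where "piecewise_C1_curve M A \<gamma> \<longleftrightarrow> pathin M \<gamma> \<and>
     piecewise (\<lambda>I. \<forall>(U, \<phi>)\<in>A. C1_on {t\<in>I. \<gamma> t \<in> U} (\<phi> \<circ> \<gamma>))"

text \<open>The speed does not depend on the chosen chart, by the transformation rule of the metric tensor.\<close>

definition riemannian_speed ::
    "('m, 'e::euclidean_space) chart set \<Rightarrow> (('m, 'e) chart \<Rightarrow> 'm \<Rightarrow> 'e \<Rightarrow> 'e \<Rightarrow> real) \<Rightarrow>
     (real \<Rightarrow> 'm) \<Rightarrow> real \<Rightarrow> real" where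
  "riemannian_speed A g \<gamma> t =
     (let c = (SOME c. c \<in> A \<and> \<gamma> t \<in> fst c); v = vector_derivative (snd c \<circ> \<gamma>) (at t)
      in sqrt (g c (\<gamma> t) v v))"

definition riemannian_dist ::
    "'m topology \<Rightarrow> ('m, 'e::euclidean_space) chart set \<Rightarrow>
     (('m, 'e) chart \<Rightarrow> 'm \<Rightarrow> 'e \<Rightarrow> 'e \<Rightarrow> real) \<Rightarrow> 'm \<Rightarrow> 'm \<Rightarrow> real" where
  "riemannian_dist M A g p q =
     (INF \<gamma> \<in> {\<gamma>. piecewise_C1_curve M A \<gamma> \<and> \<gamma> 0 = p \<and> \<gamma> 1 = q}.
        integral {0..1} (riemannian_speed A g \<gamma>))"


section \<open>Bi-Lipschitz homeomorphisms\<close>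

definition lipschitz_map ::
    "real \<Rightarrow> 'a set \<Rightarrow> ('a \<Rightarrow> 'a \<Rightarrow> real) \<Rightarrow> ('b \<Rightarrow> 'b \<Rightarrow> real) \<Rightarrow> ('a \<Rightarrow> 'b) \<Rightarrow> bool" where
  "lipschitz_map K X d e f \<longleftrightarrow> (\<forall>x\<in>X. \<forall>y\<in>X. e (f x) (f y) \<le> K * d x y)"

definition bi_lipschitz_homeomorphism ::
    "real \<Rightarrow> 'a set \<Rightarrow> ('a \<Rightarrow> 'a \<Rightarrow> real) \<Rightarrow> 'b set \<Rightarrow> ('b \<Rightarrow> 'b \<Rightarrow> real) \<Rightarrow> ('a \<Rightarrow> 'b) \<Rightarrow> bool" where
  "bi_lipschitz_homeomorphism K X d Y e f \<longleftrightarrow> K \<ge> 1 \<and> bij_betw f X Y \<and>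
     lipschitz_map K X d e f \<and> lipschitz_map K Y e d (inv_into X f)"

text \<open>A bijection that is Lipschitz in both directions is a homeomorphism; this is not required
  separately.\<close>

lemma lipschitz_map_continuous_map:
  assumes "Metric_space X d" "Metric_space Y e" "f ` X \<subseteq> Y" "lipschitz_map K X d e f"
  shows "continuous_map (Metric_space.mtopology X d) (Metric_space.mtopology Y e) f"
proof -
  have "mdist (metric (Y, e)) (f x) (f y) \<le> K * mdist (metric (X, d)) x y"
    if "x \<in> X" "y \<in> X" for x y
    using assms that by (simp add: lipschitz_map_def Metric_space.mdist_metric)
  then have "Lipschitz_continuous_map (metric (X, d)) (metric (Y, e)) f"
    using assms by (auto simp: Lipschitz_continuous_map_def Metric_space.mspace_metric)
  then show ?thesis
    using Lipschitz_continuous_imp_continuous_map assms(1,2)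
    by (metis Metric_space.mtopology_of)
qed

lemma bi_lipschitz_homeomorphism_imp_homeomorphic_maps:
  assumes "Metric_space X d" "Metric_space Y e" "bi_lipschitz_homeomorphism K X d Y e f"
  shows "homeomorphic_maps (Metric_space.mtopology X d) (Metric_space.mtopology Y e) f (inv_into X f)"
proof -
  have f: "bij_betw f X Y" "lipschitz_map K X d e f" "lipschitz_map K Y e d (inv_into X f)"
    using assms(3) by (auto simp: bi_lipschitz_homeomorphism_def)
  then have "f ` X \<subseteq> Y" "inv_into X f ` Y \<subseteq> X"
    using bij_betw_inv_into[of f X Y] by (auto simp: bij_betw_def)
  then show ?thesis
    using assms(1,2) f
    by (auto simp: homeomorphic_maps_def lipschitz_map_continuous_map Metric_space.topspace_mtopology
        bij_betw_inv_into_left bij_betw_inv_into_right)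
qed

end

theory Submission
  imports Defs
begin

text \<open>
  The proof counts rays. Let \<open>G\<close> be a \<open>K\<close>-bi-Lipschitz map from a disk around the tip of a cone of
  angle \<open>\<beta>\<close> into a cone of angle \<open>\<alpha>\<close> that takes the tip to the tip. By the intermediate value theorem
  every ray from the tip contains a point that \<open>G\<close> sends to the circle of radius \<open>r\<close>, and that point
  has distance at least \<open>r / K\<close> from the tip. The circle has length \<open>\<alpha> r\<close>. So among \<open>N + 1\<close> rays, two
  have their image points on a common arc of length \<open>\<alpha> r / N\<close>, and their points on the rays are at
  distance at most \<open>K \<alpha> r / N\<close>. But the rays can be chosen with angles at least \<open>\<beta> / (N + 1)\<close> between
  them, and then these points are at distance at least about \<open>(r / K) \<beta> / (N + 1)\<close>. Letting \<open>N\<close> tend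
  to infinity gives \<open>\<beta> \<le> K\<^sup>2 \<alpha>\<close> (\<open>conical_angle_le\<close>). The argument replaces winding numbers and lengths
  of image curves by the intermediate value theorem and the pigeonhole principle.

  The Euclidean plane is the cone of angle \<open>2\<pi>\<close>, and a Riemannian manifold is infinitesimally
  Euclidean: for every \<open>c > 1\<close> each point has a chart that is \<open>c\<close>-bi-Lipschitz onto a Euclidean ball
  (\<open>almost_isometric_chart_exists\<close>). Composing such a chart at the image of the vertex with the given
  map yields \<open>K c\<close>-bi-Lipschitz maps in both directions between a disk in the cone and a Euclidean
  ball. They are mutually inverse near the centres, so the ball has dimension two by invariance of
  domain, and the comparison of angles applies to each of them (\<open>cone_angle_bounds\<close>). This gives the
  two bounds with \<open>K c\<close> in place of \<open>K\<close>, and \<open>c\<close> tends to \<open>1\<close>.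

  The distances on both sides are infima over piecewise \<open>C\<^sup>1\<close> curves. Upper bounds come from explicit
  curves: radial segments and arcs in the cone, coordinate segments in the manifold. Lower bounds come
  from integrating a derivative along an arbitrary curve. A curve that leaves the region where the
  derivative is controlled is long because it has to reach the boundary of that region.
\<close>

section \<open>Piecewise smooth curves on the unit interval\<close>

lemma piecewiseE:
  assumes "piecewise Q"
  obtains n :: nat and t where "t 0 = 0" "t n = 1"
    "\<And>i. i < n \<Longrightarrow> t i < t (Suc i)" "\<And>i. i < n \<Longrightarrow> Q {t i..t (Suc i)}"
    "\<And>i. i \<le> n \<Longrightarrow> 0 \<le> t i \<and> t i \<le> 1"
proof -
  obtain n :: nat and t where t: "t 0 = 0" "t n = 1"
    "\<And>i. i < n \<Longrightarrow> t i < t (Suc i)" "\<And>i. i < n \<Longrightarrow> Q {t i..t (Suc i)}"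
    using assms unfolding piecewise_def by blast
  have mono: "t i \<le> t j" if "i \<le> j" "j \<le> n" for i j
    using that
  proof (induction j)
    case (Suc j)
    then show ?case
      using t(3)[of j] by (cases "i = Suc j") auto
  qed simp
  have "0 \<le> t i \<and> t i \<le> 1" if "i \<le> n" for i
    using mono[of 0 i] mono[of i n] that t(1,2) by simp
  with t show thesis
    using that by blast
qed

text \<open>
  Integrals of non-integrable functions are \<open>0\<close>, so a lower bound on lengths presupposes that the
  speed is integrable. It is enough to check this on the smooth pieces.
\<close>

lemma piecewise_integrable:
  fixes f :: "real \<Rightarrow> 'a::banach"
  assumes "piecewise Q"
    and "\<And>a b. 0 \<le> a \<Longrightarrow> a < b \<Longrightarrow> b \<le> 1 \<Longrightarrow> Q {a..b} \<Longrightarrow> f integrable_on {a..b}"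
  shows "f integrable_on {0..1}"
proof -
  obtain n :: nat and t where t: "t 0 = 0" "t n = 1"
    "\<And>i. i < n \<Longrightarrow> t i < t (Suc i)" "\<And>i. i < n \<Longrightarrow> Q {t i..t (Suc i)}"
    "\<And>i. i \<le> n \<Longrightarrow> 0 \<le> t i \<and> t i \<le> 1"
    using piecewiseE[OF assms(1)] by metis
  have "f integrable_on {0..t i}" if "i \<le> n" for i
    using that
  proof (induction i)
    case 0
    then show ?case
      using t(1) by (simp add: integrable_on_refl[of f 0, simplified])
  next
    case (Suc i)
    have "f integrable_on {t i..t (Suc i)}"
      using Suc.prems t(3-5) by (intro assms(2)) auto
    then show ?case
      using Suc t(3)[of i] t(5)[of i]
      by (intro Henstock_Kurzweil_Integration.integrable_combine[of 0 "t i" "t (Suc i)"]) auto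
  qed
  from this[of n] show ?thesis
    using t(2) by simp
qed

lemma piecewise_off_finite:
  assumes "piecewise Q"
  obtains S where "finite S"
    "\<And>x. x \<in> {0..1} - S \<Longrightarrow> \<exists>a b. 0 \<le> a \<and> a < x \<and> x < b \<and> b \<le> 1 \<and> Q {a..b}"
proof -
  obtain n :: nat and t where t: "t 0 = 0" "t n = 1"
    "\<And>i. i < n \<Longrightarrow> t i < t (Suc i)" "\<And>i. i < n \<Longrightarrow> Q {t i..t (Suc i)}"
    "\<And>i. i \<le> n \<Longrightarrow> 0 \<le> t i \<and> t i \<le> 1"
    using piecewiseE[OF assms(1)] by metis
  have "\<exists>a b. 0 \<le> a \<and> a < x \<and> x < b \<and> b \<le> 1 \<and> Q {a..b}"
    if x: "x \<in> {0..1} - t ` {..n}" for x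
  proof -
    have "x < t n"
      using x t(2) by (metis DiffE atLeastAtMost_iff atMost_iff imageI order_le_less order_refl)
    define j where "j = (LEAST j. x < t j)"
    have j: "x < t j" "j \<le> n"
      using \<open>x < t n\<close> unfolding j_def by (auto intro: LeastI Least_le)
    have "j \<noteq> 0"
      using j(1) t(1) x by auto
    then obtain i where i: "j = Suc i"
      using not0_implies_Suc by blast
    have "\<not> x < t i"
      using not_less_Least[of i "\<lambda>j. x < t j"] i by (simp add: j_def)
    moreover have "x \<noteq> t i"
      using x i j(2) by auto
    ultimately have "t i < x"
      by simp
    then show ?thesis
      using i j t(4)[of i] t(5)[of i] t(5)[of "Suc i"] by (intro exI[of _ "t i"] exI[of _ "t (Suc i)"]) auto
  qed
  then show thesis
    using that[of "t ` {..n}"] by blast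
qed

text \<open>
  The common source of all lower bounds on lengths: a function whose derivative along the curve is
  dominated by the speed cannot change by more than the length.
\<close>

lemma norm_increment_le_integral:
  fixes h :: "real \<Rightarrow> 'a::banach"
  assumes "a \<le> b" "finite S" "continuous_on {a..b} h"
    and der: "\<And>t. t \<in> {a<..<b} - S \<Longrightarrow> (h has_vector_derivative h' t) (at t)"
    and le: "\<And>t. t \<in> {a<..<b} - S \<Longrightarrow> norm (h' t) \<le> l t"
    and l: "l integrable_on {a..b}"
  shows "norm (h b - h a) \<le> integral {a..b} l"
proof -
  define T where "T = insert a (insert b S)"
  \<comment> \<open>the bounds hold only off a finite set, so the majorant is changed there\<close>
  define l' where "l' = (\<lambda>t. if t \<in> T then norm (h' t) else l t)"
  have T: "finite T" "\<And>x. x \<in> {a..b} - T \<Longrightarrow> l' x = l x"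
    using assms(2) by (auto simp: T_def l'_def)
  have h: "(h' has_integral (h b - h a)) {a..b}"
    using assms(1-3) der
    by (intro fundamental_theorem_of_calculus_interior_strong[of S]) auto
  have "l' integrable_on {a..b}"
    using l T by (subst integrable_spike_finite_eq[of T _ l' l]) auto
  moreover have "norm (h' x) \<le> l' x" if "x \<in> {a..b}" for x
    using le[of x] that by (auto simp: l'_def T_def)
  ultimately have "norm (h b - h a) \<le> integral {a..b} l'"
    using integral_norm_bound_integral[of h' "{a..b}" l'] h by (metis has_integral_iff)
  also have "integral {a..b} l' = integral {a..b} l"
    using T by (intro integral_spike[of T]) (auto intro: negligible_finite)
  finally show ?thesis .
qed

lemma integral_nonneg_total:
  fixes f :: "real \<Rightarrow> real"
  assumes "\<And>x. x \<in> S \<Longrightarrow> 0 \<le> f x"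
  shows "0 \<le> integral S f"
  using assms by (cases "f integrable_on S") (auto simp: not_integrable_integral intro: integral_nonneg)

lemma integral_subinterval_le:
  fixes f :: "real \<Rightarrow> real"
  assumes "f integrable_on {a..b}" "\<And>x. x \<in> {a..b} \<Longrightarrow> 0 \<le> f x" "a \<le> c" "d \<le> b"
  shows "integral {c..d} f \<le> integral {a..b} f"
proof (rule integral_subset_le)
  show "f integrable_on {c..d}"
    using assms by (intro integrable_subinterval_real[OF assms(1)]) auto
qed (use assms in auto)

lemma C1_on_interior_derivative:
  assumes "C1_on I \<gamma>" "t \<in> interior I"
  shows "(\<gamma> has_vector_derivative vector_derivative \<gamma> (at t)) (at t)"
proof -
  have "t \<in> I" using assms(2) interior_subset by blast
  then obtain v where "(\<gamma> has_vector_derivative v) (at t within I)"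
    using assms unfolding C1_on_def by blast
  then have "(\<gamma> has_vector_derivative v) (at t)"
    using assms(2) by (metis at_within_interior)
  then show ?thesis
    by (metis vector_derivative_at)
qed

section \<open>Lengths of curves in a cone\<close>

lemma cone_norm_nonneg [simp]: "0 \<le> cone_norm \<alpha> p v"
  by (simp add: cone_norm_def)

lemma radial_le_cone_norm: "cmod p * \<bar>Re (v / p)\<bar> \<le> cone_norm \<alpha> p v"
proof -
  have "cmod p * \<bar>Re (v / p)\<bar> = sqrt ((cmod p * Re (v / p))\<^sup>2)"
    by (simp add: abs_mult)
  also have "\<dots> \<le> cone_norm \<alpha> p v"
    unfolding cone_norm_def by (intro real_sqrt_le_mono) simp
  finally show ?thesis .
qed

lemma angular_le_cone_norm:
  assumes "0 < \<alpha>"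
  shows "\<alpha> * cmod p / (2 * pi) * \<bar>Im (v / p)\<bar> \<le> cone_norm \<alpha> p v"
proof -
  have "\<alpha> * cmod p / (2 * pi) * \<bar>Im (v / p)\<bar> = sqrt ((\<alpha> * cmod p / (2 * pi))\<^sup>2 * (Im (v / p))\<^sup>2)"
    using assms by (simp add: real_sqrt_mult abs_mult)
  also have "\<dots> \<le> cone_norm \<alpha> p v"
    unfolding cone_norm_def by (intro real_sqrt_le_mono) simp
  finally show ?thesis .
qed

lemma cone_norm_le:
  assumes "0 < \<alpha>"
  shows "cone_norm \<alpha> p v \<le> max 1 (\<alpha> / (2 * pi)) * cmod v"
proof (cases "p = 0")
  case False
  define k where "k = max 1 (\<alpha> / (2 * pi))"
  have k: "1 \<le> k" "\<alpha> / (2 * pi) \<le> k" "0 \<le> \<alpha> / (2 * pi)"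
    using assms by (auto simp: k_def)
  have "(\<alpha> * cmod p / (2 * pi))\<^sup>2 * (Im (v / p))\<^sup>2 + (cmod p * Re (v / p))\<^sup>2 
     = (\<alpha> / (2 * pi))\<^sup>2 * (cmod p * Im (v / p))\<^sup>2 + 1\<^sup>2 * (cmod p * Re (v / p))\<^sup>2"
    by (simp add: power_mult_distrib power_divide)
  also have "\<dots> \<le> k\<^sup>2 * (cmod p * Im (v / p))\<^sup>2 + k\<^sup>2 * (cmod p * Re (v / p))\<^sup>2"
    using k by (intro add_mono mult_right_mono power_mono) auto
  also have "\<dots> = k\<^sup>2 * (cmod p)\<^sup>2 * (cmod (v / p))\<^sup>2"
    by (simp add: cmod_power2 power_mult_distrib algebra_simps)
  also have "\<dots> = (k * cmod v)\<^sup>2"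
    using False by (simp add: norm_divide power_mult_distrib power_divide)
  finally have "cone_norm \<alpha> p v \<le> sqrt ((k * cmod v)\<^sup>2)"
    unfolding cone_norm_def by (rule real_sqrt_le_mono)
  then show ?thesis
    using k by (simp add: k_def)
qed (simp add: cone_norm_def)

abbreviation cone_curve :: "(real \<Rightarrow> complex) \<Rightarrow> bool" where
  "cone_curve \<gamma> \<equiv> path \<gamma> \<and> piecewise (\<lambda>I. C1_on I \<gamma>)"

abbreviation cone_speed :: "real \<Rightarrow> (real \<Rightarrow> complex) \<Rightarrow> real \<Rightarrow> real" where
  "cone_speed \<alpha> \<gamma> t \<equiv> cone_norm \<alpha> (\<gamma> t) (vector_derivative \<gamma> (at t))"

text \<open>
  The norm of the cone is discontinuous at the tip, so the speed need not be piecewise continuous. It is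
  a measurable function dominated by a multiple of the Euclidean speed.
\<close>

lemma cone_speed_integrable:
  assumes \<alpha>: "0 < \<alpha>" and pw: "piecewise (\<lambda>I. C1_on I \<gamma>)"
  shows "cone_speed \<alpha> \<gamma> integrable_on {0..1}"
proof (rule piecewise_integrable[OF pw])
  fix a b :: real
  assume ab: "a < b" and C1: "C1_on {a..b} \<gamma>"
  then obtain D where D: "continuous_on {a..b} D"
    "\<And>t. t \<in> {a..b} \<Longrightarrow> (\<gamma> has_vector_derivative D t) (at t within {a..b})"
    unfolding C1_on_def by blast
  have \<gamma>: "continuous_on {a..b} \<gamma>"
    using D(2) has_vector_derivative_continuous continuous_on_eq_continuous_within by blast
  have meas: "\<gamma> \<in> borel_measurable (lebesgue_on {a..b})" "D \<in> borel_measurable (lebesgue_on {a..b})"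
    using \<gamma> D(1) by (auto intro!: continuous_imp_measurable_on_sets_lebesgue)
  have "(\<lambda>t. cone_norm \<alpha> (\<gamma> t) (D t)) \<in> borel_measurable (lebesgue_on {a..b})"
    unfolding cone_norm_def using meas by measurable
  then have "(\<lambda>t. cone_norm \<alpha> (\<gamma> t) (D t)) integrable_on {a..b}"
  proof (rule measurable_bounded_by_integrable_imp_integrable)
    show "(\<lambda>t. max 1 (\<alpha> / (2 * pi)) * cmod (D t)) integrable_on {a..b}"
      using D(1) by (intro integrable_continuous_real continuous_intros)
  qed (use cone_norm_le[OF \<alpha>] in auto)
  moreover have "D t = vector_derivative \<gamma> (at t)" if "t \<in> {a..b} - {a, b}" for t
  proof -
    have "(\<gamma> has_vector_derivative D t) (at t)"
      using D(2)[of t] that by (simp add: at_within_Icc_at)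
    then show ?thesis
      by (simp add: vector_derivative_at)
  qed
  ultimately show "cone_speed \<alpha> \<gamma> integrable_on {a..b}"
    by (subst integrable_spike_finite_eq[of "{a, b}" _ _ "\<lambda>t. cone_norm \<alpha> (\<gamma> t) (D t)"]) auto
qed

lemma cone_curve_off_finite:
  assumes "piecewise (\<lambda>I. C1_on I \<gamma>)"
  obtains S where "finite S"
    "\<And>t. t \<in> {0..1} - S \<Longrightarrow> (\<gamma> has_vector_derivative vector_derivative \<gamma> (at t)) (at t)"
    "\<And>t. t \<in> {0..1} - S \<Longrightarrow> isCont (\<lambda>t. vector_derivative \<gamma> (at t)) t"
proof -
  obtain S where S: "finite S"
    "\<And>x. x \<in> {0..1} - S \<Longrightarrow> \<exists>a b. 0 \<le> a \<and> a < x \<and> x < b \<and> b \<le> 1 \<and> C1_on {a..b} \<gamma>"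
    using piecewise_off_finite[OF assms] by metis
  show thesis
  proof (rule that[OF S(1)])
    fix t assume "t \<in> {0..1} - S"
    then obtain a b where ab: "a < t" "t < b" "C1_on {a..b} \<gamma>"
      using S(2) by blast
    then show "(\<gamma> has_vector_derivative vector_derivative \<gamma> (at t)) (at t)"
      using C1_on_interior_derivative[of "{a..b}" \<gamma> t] by simp
    obtain D where D: "continuous_on {a..b} D"
      "\<And>t. t \<in> {a..b} \<Longrightarrow> (\<gamma> has_vector_derivative D t) (at t within {a..b})"
      using ab(3) unfolding C1_on_def by blast
    have "vector_derivative \<gamma> (at s) = D s" if "s \<in> {a<..<b}" for s
      using D(2)[of s] that by (simp add: at_within_Icc_at vector_derivative_at)
    moreover have "continuous_on {a<..<b} D"
      using D(1) by (rule continuous_on_subset) auto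
    ultimately have "continuous_on {a<..<b} (\<lambda>s. vector_derivative \<gamma> (at s))"
      by (metis (no_types, lifting) continuous_on_cong)
    then show "isCont (\<lambda>t. vector_derivative \<gamma> (at t)) t"
      using ab by (simp add: continuous_on_eq_continuous_at)
  qed
qed

text \<open>
  The distance to the tip is not differentiable at the tip, through which the curve may pass. The smooth
  approximations \<open>sqrt (r\<^sup>2 + \<epsilon>\<^sup>2)\<close> have derivative at most the speed everywhere.
\<close>

lemma radius_increment_le:
  assumes \<alpha>: "0 < \<alpha>" and \<gamma>: "cone_curve \<gamma>" and ab: "0 \<le> a" "a \<le> b" "b \<le> 1"
  shows "\<bar>cmod (\<gamma> b) - cmod (\<gamma> a)\<bar> \<le> integral {a..b} (cone_speed \<alpha> \<gamma>)"
proof -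
  obtain S where S: "finite S"
    "\<And>t. t \<in> {0..1} - S \<Longrightarrow> (\<gamma> has_vector_derivative vector_derivative \<gamma> (at t)) (at t)"
    using cone_curve_off_finite \<gamma> by metis
  have int: "cone_speed \<alpha> \<gamma> integrable_on {a..b}"
    by (rule integrable_subinterval_real[OF cone_speed_integrable[OF \<alpha> conjunct2[OF \<gamma>]]]) (use ab in auto)
  have cont: "continuous_on {a..b} \<gamma>"
    using \<gamma> ab unfolding path_def by (auto elim: continuous_on_subset)
  have *: "\<bar>sqrt ((cmod (\<gamma> b))\<^sup>2 + e\<^sup>2) - sqrt ((cmod (\<gamma> a))\<^sup>2 + e\<^sup>2)\<bar> \<le> integral {a..b} (cone_speed \<alpha> \<gamma>)"
    if "e > 0" for e
  proof -
    define h where "h = (\<lambda>t. sqrt ((cmod (\<gamma> t))\<^sup>2 + e\<^sup>2))"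
    define h' where "h' = (\<lambda>t. (\<gamma> t \<bullet> vector_derivative \<gamma> (at t)) / h t)"
    have h: "h t > 0" "cmod (\<gamma> t) \<le> h t" for t
    proof -
      show "h t > 0"
        using that by (simp add: h_def add_nonneg_pos)
      have "sqrt ((cmod (\<gamma> t))\<^sup>2) \<le> h t"
        unfolding h_def by (rule real_sqrt_le_mono) simp
      then show "cmod (\<gamma> t) \<le> h t" by simp
    qed
    have "norm (h b - h a) \<le> integral {a..b} (cone_speed \<alpha> \<gamma>)"
    proof (rule norm_increment_le_integral[OF ab(2) S(1) _ _ _ int, of h h'])
      show "continuous_on {a..b} h"
        unfolding h_def by (intro continuous_intros cont)
      fix t assume t: "t \<in> {a<..<b} - S"
      define v where "v = vector_derivative \<gamma> (at t)"
      have v: "(\<gamma> has_derivative (\<lambda>s. s *\<^sub>R v)) (at t)"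
        using S(2)[of t] t ab by (simp add: has_vector_derivative_def v_def)
      have "((\<lambda>t. (cmod (\<gamma> t))\<^sup>2 + e\<^sup>2) has_real_derivative 2 * (\<gamma> t \<bullet> v)) (at t)"
        unfolding power2_norm_eq_inner has_field_derivative_def
        using v by (auto intro!: derivative_eq_intros simp: inner_commute)
      moreover have "0 < (cmod (\<gamma> t))\<^sup>2 + e\<^sup>2"
        using that by (simp add: add_nonneg_pos)
      ultimately have "(h has_real_derivative inverse (h t) / 2 * (2 * (\<gamma> t \<bullet> v))) (at t)"
        unfolding h_def by (intro DERIV_chain2[OF DERIV_real_sqrt])
      moreover have "inverse (h t) / 2 * (2 * (\<gamma> t \<bullet> v)) = h' t"
        unfolding h'_def v_def[symmetric] by (simp add: field_simps)
      ultimately show "(h has_vector_derivative h' t) (at t)"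
        by (simp only: has_real_derivative_iff_has_vector_derivative)
      have "\<gamma> t \<bullet> v = (cmod (\<gamma> t))\<^sup>2 * Re (v / \<gamma> t)"
      proof (cases "\<gamma> t = 0")
        case False
        then obtain z where z: "v = z * \<gamma> t"
          by (metis nonzero_eq_divide_eq)
        then have "v / \<gamma> t = z"
          using False by simp
        then have "(cmod (\<gamma> t))\<^sup>2 * Re (v / \<gamma> t) = ((Re (\<gamma> t))\<^sup>2 + (Im (\<gamma> t))\<^sup>2) * Re z"
          by (simp add: cmod_power2)
        also have "\<dots> = \<gamma> t \<bullet> v"
          unfolding z inner_complex_def by (simp add: algebra_simps power2_eq_square)
        finally show ?thesis
          by simp
      qed simp
      then have "\<bar>h' t\<bar> = cmod (\<gamma> t) / h t * (cmod (\<gamma> t) * \<bar>Re (v / \<gamma> t)\<bar>)"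
        using h(1)[of t] by (simp add: h'_def v_def abs_mult power2_eq_square)
      also have "\<dots> \<le> 1 * cone_norm \<alpha> (\<gamma> t) v"
        using h[of t] by (intro mult_mono radial_le_cone_norm) auto
      finally show "norm (h' t) \<le> cone_speed \<alpha> \<gamma> t"
        by (simp add: v_def)
    qed
    then show ?thesis
      by (simp add: h_def)
  qed
  have "((\<lambda>e. \<bar>sqrt ((cmod (\<gamma> b))\<^sup>2 + e\<^sup>2) - sqrt ((cmod (\<gamma> a))\<^sup>2 + e\<^sup>2)\<bar>) \<longlongrightarrow>
      \<bar>sqrt ((cmod (\<gamma> b))\<^sup>2 + 0\<^sup>2) - sqrt ((cmod (\<gamma> a))\<^sup>2 + 0\<^sup>2)\<bar>) (at_right 0)"
    by (intro tendsto_intros)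
  moreover have "eventually (\<lambda>e. \<bar>sqrt ((cmod (\<gamma> b))\<^sup>2 + e\<^sup>2) - sqrt ((cmod (\<gamma> a))\<^sup>2 + e\<^sup>2)\<bar>
      \<le> integral {a..b} (cone_speed \<alpha> \<gamma>)) (at_right 0)"
    using * by (auto simp: eventually_at_right_field intro: exI[of _ 1])
  ultimately show ?thesis
    using tendsto_upperbound by fastforce
qed

lemma abs_Arg_exp_le: "\<bar>Arg (exp z)\<bar> \<le> \<bar>Im z\<bar>"
proof (cases "\<bar>Im z\<bar> < pi")
  case True
  then show ?thesis
    by (simp add: Arg_exp)
next
  case False
  then show ?thesis
    using Arg_bounded[of "exp z"] by linarith
qed

text \<open>
  Away from the tip the curve has a continuous logarithm, the integral \<open>\<Phi>\<close> of \<open>\<gamma>' / \<gamma>\<close>. Its imaginary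
  part measures the angle swept out, and the angular part of the speed controls its derivative. The
  principal argument is the angle of least absolute value.
\<close>

lemma angle_increment_le:
  assumes \<alpha>: "0 < \<alpha>" and \<gamma>: "cone_curve \<gamma>" and m: "0 < m" "\<And>t. t \<in> {0..1} \<Longrightarrow> m \<le> cmod (\<gamma> t)"
  shows "\<alpha> * m / (2 * pi) * \<bar>Arg (\<gamma> 1 / \<gamma> 0)\<bar> \<le> cone_length \<alpha> \<gamma>"
proof -
  obtain S where S: "finite S"
    "\<And>t. t \<in> {0..1} - S \<Longrightarrow> (\<gamma> has_vector_derivative vector_derivative \<gamma> (at t)) (at t)"
    "\<And>t. t \<in> {0..1} - S \<Longrightarrow> isCont (\<lambda>t. vector_derivative \<gamma> (at t)) t"
    using cone_curve_off_finite \<gamma> by metis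
  have cont: "continuous_on {0..1} \<gamma>"
    using \<gamma> unfolding path_def by simp
  have nz: "\<gamma> t \<noteq> 0" if "t \<in> {0..1}" for t
    using m that by fastforce
  define w where "w = (\<lambda>t. vector_derivative \<gamma> (at t) / \<gamma> t)"
  define \<Phi> where "\<Phi> = (\<lambda>t. integral {0..t} w)"
  have w: "w integrable_on {0..1}"
  proof (rule piecewise_integrable)
    show "piecewise (\<lambda>I. C1_on I \<gamma>)" using \<gamma> by simp
    fix a b :: real
    assume ab: "0 \<le> a" "a < b" "b \<le> 1" and C1: "C1_on {a..b} \<gamma>"
    then obtain D where D: "continuous_on {a..b} D"
      "\<And>t. t \<in> {a..b} \<Longrightarrow> (\<gamma> has_vector_derivative D t) (at t within {a..b})"
      unfolding C1_on_def by blast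
    have "continuous_on {a..b} (\<lambda>t. D t / \<gamma> t)"
      using ab nz cont by (intro continuous_intros D) (auto elim: continuous_on_subset)
    moreover have "w t = D t / \<gamma> t" if "t \<in> {a..b} - {a, b}" for t
      using D(2)[of t] that by (simp add: at_within_Icc_at vector_derivative_at w_def)
    ultimately show "w integrable_on {a..b}"
      by (subst integrable_spike_finite_eq[of "{a, b}" _ _ "\<lambda>t. D t / \<gamma> t"])
        (auto intro: integrable_continuous_real)
  qed
  have \<Phi>: "continuous_on {0..1} \<Phi>"
    unfolding \<Phi>_def using w by (rule indefinite_integral_continuous_1)
  have \<Phi>': "(\<Phi> has_vector_derivative w t) (at t)" if t: "t \<in> {0<..<1} - S" for t
  proof -
    have "isCont \<gamma> t"
      using S(2)[of t] t has_vector_derivative_continuous by auto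
    then have "isCont w t"
      unfolding w_def using S(3)[of t] nz[of t] t by (intro continuous_intros) auto
    then have "(\<Phi> has_vector_derivative w t) (at t within {0..1})"
      unfolding \<Phi>_def using t integral_has_vector_derivative_continuous_at[OF w, of t "{}"]
      by (auto intro: continuous_at_imp_continuous_at_within)
    then show ?thesis
      using t by (simp add: at_within_Icc_at)
  qed
  \<comment> \<open>constant, because its derivative vanishes off a finite set\<close>
  define \<eta> where "\<eta> = (\<lambda>t. \<gamma> t * exp (- \<Phi> t))"
  have "((\<lambda>t :: real. 0) has_integral (\<eta> 1 - \<eta> 0)) {0..1}"
  proof (rule fundamental_theorem_of_calculus_interior_strong[OF S(1)])
    show "continuous_on {0..1} \<eta>"
      unfolding \<eta>_def by (intro continuous_intros cont \<Phi>)
    fix t assume t: "t \<in> {0<..<1} - S"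
    have "((\<lambda>t. \<gamma> t * exp (- \<Phi> t)) has_vector_derivative
        \<gamma> t * (- w t * exp (- \<Phi> t)) + vector_derivative \<gamma> (at t) * exp (- \<Phi> t)) (at t)"
      using S(2)[of t] \<Phi>'[OF t] t
      by (intro has_vector_derivative_mult field_vector_diff_chain_at[where g = exp, unfolded o_def])
        (auto intro!: derivative_eq_intros)
    then show "(\<eta> has_vector_derivative 0) (at t)"
      using nz[of t] t by (simp add: w_def \<eta>_def)
  qed simp
  then have "\<gamma> 1 * exp (- \<Phi> 1) - \<gamma> 0 * exp (- \<Phi> 0) = 0"
    using has_integral_unique has_integral_0 unfolding \<eta>_def by blast
  then have "\<gamma> 1 / \<gamma> 0 = exp (\<Phi> 1)"
    using nz[of 0] by (simp add: \<Phi>_def exp_minus field_simps)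
  then have "\<alpha> * m / (2 * pi) * \<bar>Arg (\<gamma> 1 / \<gamma> 0)\<bar> \<le> \<alpha> * m / (2 * pi) * \<bar>Im (\<Phi> 1)\<bar>"
    using \<alpha> m(1) by (intro mult_left_mono) (auto simp: abs_Arg_exp_le)
  also have "\<dots> = norm (\<alpha> * m / (2 * pi) * Im (\<Phi> 1) - \<alpha> * m / (2 * pi) * Im (\<Phi> 0))"
    using \<alpha> m(1) by (simp add: \<Phi>_def abs_mult)
  also have "\<dots> \<le> integral {0..1} (cone_speed \<alpha> \<gamma>)"
  proof (rule norm_increment_le_integral[OF _ S(1), where h = "\<lambda>t. \<alpha> * m / (2 * pi) * Im (\<Phi> t)"
        and h' = "\<lambda>t. \<alpha> * m / (2 * pi) * Im (w t)"])
    fix t assume t: "t \<in> {0<..<1} - S"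
    show "((\<lambda>t. \<alpha> * m / (2 * pi) * Im (\<Phi> t)) has_vector_derivative \<alpha> * m / (2 * pi) * Im (w t)) (at t)"
      using bounded_linear.has_vector_derivative[OF bounded_linear_Im \<Phi>'[OF t]]
      by (intro has_vector_derivative_mult_right)
    have "norm (\<alpha> * m / (2 * pi) * Im (w t)) = \<alpha> * m / (2 * pi) * \<bar>Im (w t)\<bar>"
      using \<alpha> m(1) by (simp add: abs_mult)
    also have "\<dots> \<le> \<alpha> * cmod (\<gamma> t) / (2 * pi) * \<bar>Im (w t)\<bar>"
      using \<alpha> m(2)[of t] t by (intro mult_right_mono divide_right_mono mult_left_mono) auto
    also have "\<dots> \<le> cone_speed \<alpha> \<gamma> t"
      unfolding w_def by (rule angular_le_cone_norm[OF \<alpha>])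
    finally show "norm (\<alpha> * m / (2 * pi) * Im (w t)) \<le> cone_speed \<alpha> \<gamma> t" .
  qed (use \<Phi> cone_speed_integrable[OF \<alpha> conjunct2[OF \<gamma>]] in \<open>auto intro!: continuous_intros\<close>)
  finally show ?thesis
    by (simp add: cone_length_def)
qed

lemma cone_dist_le_length:
  assumes "cone_curve \<gamma>"
  shows "cone_dist \<alpha> (\<gamma> 0) (\<gamma> 1) \<le> cone_length \<alpha> \<gamma>"
  unfolding cone_dist_def
proof (rule cINF_lower)
  show "bdd_below (cone_length \<alpha> ` {\<delta>. path \<delta> \<and> piecewise (\<lambda>I. C1_on I \<delta>) \<and> \<delta> 0 = \<gamma> 0 \<and> \<delta> 1 = \<gamma> 1})"
    by (intro bdd_belowI2[of _ 0]) (auto simp: cone_length_def intro!: integral_nonneg_total)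
qed (use assms in auto)

lemma C1_imp_cone_curve:
  assumes "\<And>t. (\<gamma> has_vector_derivative D t) (at t)" "continuous_on {0..1} D"
  shows "cone_curve \<gamma>"
proof
  show "path \<gamma>"
    unfolding path_def using assms(1)
    by (meson continuous_at_imp_continuous_on has_vector_derivative_continuous)
  have "C1_on {0..1} \<gamma>"
    unfolding C1_on_def using assms by (meson has_vector_derivative_at_within)
  then show "piecewise (\<lambda>I. C1_on I \<gamma>)"
    unfolding piecewise_def by (intro exI[of _ 1] exI[of _ real]) auto
qed

lemma cone_dist_le:
  assumes \<alpha>: "0 < \<alpha>"
    and der: "\<And>t. (\<gamma> has_vector_derivative D t) (at t)" and cont: "continuous_on {0..1} D"
    and L: "\<And>t. t \<in> {0..1} \<Longrightarrow> cone_norm \<alpha> (\<gamma> t) (D t) \<le> L"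
  shows "cone_dist \<alpha> (\<gamma> 0) (\<gamma> 1) \<le> L"
proof -
  have \<gamma>: "cone_curve \<gamma>"
    using C1_imp_cone_curve der cont by blast
  have "integral {0..1} (cone_speed \<alpha> \<gamma>) \<le> integral {0..1} (\<lambda>_ :: real. L)"
  proof (rule integral_le)
    show "cone_speed \<alpha> \<gamma> integrable_on {0..1}"
      by (rule cone_speed_integrable[OF \<alpha> conjunct2[OF \<gamma>]])
    show "cone_speed \<alpha> \<gamma> t \<le> L" if "t \<in> {0..1}" for t
      using L[OF that] vector_derivative_at[OF der] by simp
  qed auto
  then show ?thesis
    using cone_dist_le_length[OF \<gamma>, of \<alpha>] by (simp add: cone_length_def)
qed

lemma has_vector_derivative_segment:
  "((\<lambda>t. p + t *\<^sub>R w) has_vector_derivative w) (at t)"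
  by (auto intro!: derivative_eq_intros)

lemma cone_dist_le_segment:
  assumes "0 < \<alpha>"
  shows "cone_dist \<alpha> p q \<le> max 1 (\<alpha> / (2 * pi)) * cmod (p - q)"
proof -
  have "cone_dist \<alpha> ((\<lambda>t. p + t *\<^sub>R (q - p)) 0) ((\<lambda>t. p + t *\<^sub>R (q - p)) 1)
      \<le> max 1 (\<alpha> / (2 * pi)) * cmod (q - p)"
    by (rule cone_dist_le[OF assms has_vector_derivative_segment]) (auto simp only: cone_norm_le[OF assms] continuous_on_const)
  then show ?thesis
    by (simp add: norm_minus_commute)
qed

lemma cone_dist_greatest:
  assumes "\<And>\<gamma>. cone_curve \<gamma> \<Longrightarrow> \<gamma> 0 = p \<Longrightarrow> \<gamma> 1 = q \<Longrightarrow> B \<le> cone_length \<alpha> \<gamma>"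
  shows "B \<le> cone_dist \<alpha> p q"
  unfolding cone_dist_def
proof (rule cINF_greatest)
  have "cone_curve (\<lambda>t. p + t *\<^sub>R (q - p))"
    by (rule C1_imp_cone_curve[OF has_vector_derivative_segment]) auto
  then show "{\<gamma>. path \<gamma> \<and> piecewise (\<lambda>I. C1_on I \<gamma>) \<and> \<gamma> 0 = p \<and> \<gamma> 1 = q} \<noteq> {}"
    by (auto intro!: exI[of _ "\<lambda>t. p + t *\<^sub>R (q - p)"])
qed (use assms in auto)

section \<open>Conical distances\<close>

text \<open>
  The features of the distance \<open>D\<close> of a cone of angle \<open>\<alpha>\<close> that enter the comparison of angles, in the
  polar coordinates of the plane. In the last one the minimum is there because a curve between points at
  distance at least \<open>m\<close> from the tip may take a shortcut close to the tip. Then it is long for another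
  reason: it descends from radius \<open>\<bar>p\<bar>\<close> to radius \<open>m\<close>.
\<close>

locale conical =
  fixes \<alpha> :: real and D :: "complex \<Rightarrow> complex \<Rightarrow> real"
  assumes angle_pos: "0 < \<alpha>"
    and radius_le: "\<bar>cmod p - cmod q\<bar> \<le> D p q"
    and radial_le: "0 \<le> s \<Longrightarrow> 0 \<le> t \<Longrightarrow> D (of_real s * cis \<theta>) (of_real t * cis \<theta>) \<le> \<bar>s - t\<bar>"
    and arc_le: "0 \<le> s \<Longrightarrow> D (of_real s * cis \<theta>) (of_real s * cis \<eta>) \<le> \<alpha> / (2 * pi) * s * \<bar>\<theta> - \<eta>\<bar>"
    and angle_le: "0 < m \<Longrightarrow> m \<le> cmod p \<Longrightarrow>
      min (cmod p - m) (\<alpha> / (2 * pi) * m * \<bar>Arg (q / p)\<bar>) \<le> D p q"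

lemma conical_cone_dist:
  assumes \<alpha>: "0 < \<alpha>"
  shows "conical \<alpha> (cone_dist \<alpha>)"
proof
  fix p q
  show "\<bar>cmod p - cmod q\<bar> \<le> cone_dist \<alpha> p q"
  proof (rule cone_dist_greatest)
    fix \<gamma> assume "cone_curve \<gamma>" "\<gamma> 0 = p" "\<gamma> 1 = q"
    then show "\<bar>cmod p - cmod q\<bar> \<le> cone_length \<alpha> \<gamma>"
      using radius_increment_le[OF \<alpha>, of \<gamma> 0 1] by (simp add: cone_length_def abs_minus_commute)
  qed
next
  fix s t \<theta> :: real
  assume "0 \<le> s" "0 \<le> t"
  have "cone_dist \<alpha> ((\<lambda>x. s *\<^sub>R cis \<theta> + x *\<^sub>R (t - s) *\<^sub>R cis \<theta>) 0)
     ((\<lambda>x. s *\<^sub>R cis \<theta> + x *\<^sub>R (t - s) *\<^sub>R cis \<theta>) 1) \<le> \<bar>s - t\<bar>"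
  proof (rule cone_dist_le[OF \<alpha> has_vector_derivative_segment])
    fix x :: real
    define k where "k = s + x * (t - s)"
    have "s *\<^sub>R cis \<theta> + x *\<^sub>R (t - s) *\<^sub>R cis \<theta> = k *\<^sub>R cis \<theta>"
      by (simp add: k_def algebra_simps)
    moreover have "(t - s) *\<^sub>R cis \<theta> / (k *\<^sub>R cis \<theta>) = of_real ((t - s) / k)"
      by (simp add: scaleR_conv_of_real)
    ultimately show "cone_norm \<alpha> (s *\<^sub>R cis \<theta> + x *\<^sub>R (t - s) *\<^sub>R cis \<theta>) ((t - s) *\<^sub>R cis \<theta>) \<le> \<bar>s - t\<bar>"
      by (simp add: cone_norm_def abs_mult abs_minus_commute)
  qed auto
  then show "cone_dist \<alpha> (of_real s * cis \<theta>) (of_real t * cis \<theta>) \<le> \<bar>s - t\<bar>"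
    by (simp add: scaleR_conv_of_real algebra_simps)
next
  fix s \<theta> \<eta> :: real
  assume s: "0 \<le> s"
  define \<gamma> where "\<gamma> = (\<lambda>x. of_real s * cis (\<theta> + x * (\<eta> - \<theta>)))"
  have "cone_dist \<alpha> (\<gamma> 0) (\<gamma> 1) \<le> \<alpha> / (2 * pi) * s * \<bar>\<theta> - \<eta>\<bar>"
  proof (rule cone_dist_le[OF \<alpha>])
    fix x :: real
    have exp: "\<gamma> = (\<lambda>x. of_real s * exp (\<i> * of_real \<theta> + x *\<^sub>R (\<i> * of_real (\<eta> - \<theta>))))"
      by (simp add: fun_eq_iff \<gamma>_def cis_conv_exp scaleR_conv_of_real algebra_simps)
    have "(\<gamma> has_vector_derivative of_real s * (\<i> * of_real (\<eta> - \<theta>) *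
        exp (\<i> * of_real \<theta> + x *\<^sub>R (\<i> * of_real (\<eta> - \<theta>))))) (at x)"
      unfolding exp
      by (intro has_vector_derivative_mult_right
          field_vector_diff_chain_at[OF has_vector_derivative_segment DERIV_exp, unfolded o_def])
    then show "(\<gamma> has_vector_derivative \<i> * of_real (\<eta> - \<theta>) * \<gamma> x) (at x)"
      by (simp add: exp mult.left_commute mult.assoc)
    show "cone_norm \<alpha> (\<gamma> x) (\<i> * of_real (\<eta> - \<theta>) * \<gamma> x) \<le> \<alpha> / (2 * pi) * s * \<bar>\<theta> - \<eta>\<bar>"
    proof (cases "s = 0")
      case False
      then have "\<i> * of_real (\<eta> - \<theta>) * \<gamma> x / \<gamma> x = \<i> * of_real (\<eta> - \<theta>)"
        by (simp add: \<gamma>_def)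
      moreover have "cmod (\<gamma> x) = s"
        using s by (simp add: \<gamma>_def norm_mult)
      ultimately show ?thesis
        unfolding cone_norm_def using \<alpha> s by (simp add: real_sqrt_mult abs_minus_commute)
    qed (simp add: cone_norm_def \<gamma>_def)
  qed (auto simp: \<gamma>_def intro!: continuous_intros)
  then show "cone_dist \<alpha> (of_real s * cis \<theta>) (of_real s * cis \<eta>) \<le> \<alpha> / (2 * pi) * s * \<bar>\<theta> - \<eta>\<bar>"
    by (simp add: \<gamma>_def)
next
  fix m p q
  assume m: "0 < m" "m \<le> cmod p"
  show "min (cmod p - m) (\<alpha> / (2 * pi) * m * \<bar>Arg (q / p)\<bar>) \<le> cone_dist \<alpha> p q"
  proof (rule cone_dist_greatest)
    fix \<gamma> assume \<gamma>: "cone_curve \<gamma>" "\<gamma> 0 = p" "\<gamma> 1 = q"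
    show "min (cmod p - m) (\<alpha> / (2 * pi) * m * \<bar>Arg (q / p)\<bar>) \<le> cone_length \<alpha> \<gamma>"
    proof (cases "\<forall>t\<in>{0..1}. m \<le> cmod (\<gamma> t)")
      case True
      then show ?thesis
        using angle_increment_le[OF \<alpha> \<gamma>(1) m(1)] \<gamma>(2,3) by (simp add: mult_ac)
    next
      case False
      then obtain t where t: "t \<in> {0..1}" "cmod (\<gamma> t) < m"
        by force
      have "cmod p - m \<le> integral {0..t} (cone_speed \<alpha> \<gamma>)"
        using radius_increment_le[OF \<alpha> \<gamma>(1), of 0 t] t \<gamma>(2) by auto
      also have "\<dots> \<le> cone_length \<alpha> \<gamma>"
        unfolding cone_length_def
        using t by (intro integral_subinterval_le cone_speed_integrable[OF \<alpha> conjunct2[OF \<gamma>(1)]]) auto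
      finally show ?thesis
        by simp
    qed
  qed
qed (fact \<alpha>)

lemma dist_cis_le: "cmod (cis \<theta> - cis \<eta>) \<le> \<bar>\<theta> - \<eta>\<bar>"
proof -
  have "cis \<theta> - cis \<eta> = cis \<eta> * (exp (\<i> * of_real (\<theta> - \<eta>)) - 1)"
    unfolding cis_conv_exp[symmetric] by (simp add: cis_mult right_diff_distrib)
  then have "cmod (cis \<theta> - cis \<eta>) = 2 * \<bar>sin ((\<theta> - \<eta>) / 2)\<bar>"
    by (simp add: norm_mult dist_exp_i_1 del: of_real_diff)
  also have "\<dots> \<le> 2 * \<bar>(\<theta> - \<eta>) / 2\<bar>"
    using abs_sin_x_le_abs_x[of "(\<theta> - \<eta>) / 2"] by simp
  finally show ?thesis by simp
qed

text \<open>
  The cone of angle \<open>2\<pi>\<close> is the Euclidean plane. The lower bound in terms of angles carries over from the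
  cone, because straight segments show that its distance is at most the Euclidean one.
\<close>

lemma conical_dist: "conical (2 * pi) dist"
proof
  fix s t \<theta> :: real
  have "of_real s * cis \<theta> - of_real t * cis \<theta> = of_real (s - t) * cis \<theta>"
    by (simp add: algebra_simps)
  then show "dist (of_real s * cis \<theta>) (of_real t * cis \<theta>) \<le> \<bar>s - t\<bar>"
    by (simp add: dist_norm norm_mult flip: of_real_diff)
next
  fix s \<theta> \<eta> :: real
  assume "0 \<le> s"
  then show "dist (of_real s * cis \<theta>) (of_real s * cis \<eta>) \<le> 2 * pi / (2 * pi) * s * \<bar>\<theta> - \<eta>\<bar>"
    using dist_cis_le[of \<theta> \<eta>] by (simp add: dist_norm norm_mult mult_left_mono flip: right_diff_distrib)
next
  fix m p q
  assume m: "0 < m" "m \<le> cmod p"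
  show "min (cmod p - m) (2 * pi / (2 * pi) * m * \<bar>Arg (q / p)\<bar>) \<le> dist p q"
    using conical.angle_le[OF conical_cone_dist m, of "2 * pi" q] cone_dist_le_segment[of "2 * pi" p q]
    by (simp add: dist_norm)
qed (use norm_triangle_ineq3 in \<open>auto simp: dist_norm\<close>)

lemma (in conical) eq_if_dist_nonpos:
  assumes "D p q \<le> 0"
  shows "p = q"
proof (cases "p = 0")
  case False
  have norm: "cmod p = cmod q"
    using radius_le[of p q] assms by linarith
  have "min (cmod p - cmod p / 2) (\<alpha> / (2 * pi) * (cmod p / 2) * \<bar>Arg (q / p)\<bar>) \<le> 0"
    using angle_le[of "cmod p / 2" p q] assms False by simp
  then have "\<alpha> / (2 * pi) * (cmod p / 2) * \<bar>Arg (q / p)\<bar> \<le> 0"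
    using False by (simp add: min_le_iff_disj)
  moreover have "0 < \<alpha> / (2 * pi) * (cmod p / 2)"
    using False angle_pos by simp
  ultimately have "Arg (q / p) = 0"
    by (metis abs_le_zero_iff mult_le_cancel_left_pos mult_zero_right)
  moreover have "cmod (q / p) = 1"
    using norm False by (auto simp: norm_divide)
  ultimately have "q / p = 1"
    using rcis_cmod_Arg[of "q / p"] by simp
  then show ?thesis
    by simp
next
  case True
  moreover have "\<bar>cmod p - cmod q\<bar> \<le> 0"
    using radius_le assms by (rule order_trans)
  ultimately show ?thesis
    by simp
qed

section \<open>Bi-Lipschitz maps and cone angles\<close>

lemma abs_Arg_cis_equispaced:
  assumes "j < k" "k < M"
  shows "2 * pi / real M \<le> \<bar>Arg (cis (2 * pi * real k / real M) / cis (2 * pi * real j / real M))\<bar>"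
proof -
  define x where "x = 2 * pi * real (k - j) / real M"
  have eq: "cis (2 * pi * real k / real M) / cis (2 * pi * real j / real M) = cis x"
    using assms by (simp add: x_def cis_divide of_nat_diff diff_divide_distrib right_diff_distrib)
  have M: "0 < real M" "1 \<le> real (k - j)" "real (k - j) \<le> real M - 1"
    using assms by auto
  have x: "2 * pi / M \<le> x" "x \<le> 2 * pi - 2 * pi / M"
  proof -
    show "2 * pi / M \<le> x"
      using M by (simp add: x_def divide_right_mono)
    have "x \<le> 2 * pi * (real M - 1) / M"
      unfolding x_def using M by (intro divide_right_mono mult_left_mono) auto
    then show "x \<le> 2 * pi - 2 * pi / M"
      using M(1) by (simp add: field_simps)
  qed
  show ?thesis
  proof (cases "x \<le> pi")
    case True
    have "- pi < x"
      using x(1) M(1) by (smt (verit) divide_pos_pos pi_gt_zero)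
    then have "Arg (cis x) = x"
      using True by (simp add: Arg_cis)
    then show ?thesis
      using x(1) eq by simp
  next
    case False
    have "0 < 2 * pi / M" using M(1) by simp
    then have "Arg (cis (x - 2 * pi)) = x - 2 * pi"
      using False x(2) by (intro Arg_cis) auto
    moreover have "cis (x - 2 * pi) = cis x"
      by (simp add: complex_eq_iff cos_diff sin_diff)
    ultimately show ?thesis
      using x(2) eq by (simp add: \<open>0 < 2 * pi / M\<close>)
  qed
qed

text \<open>
  The circle is divided into \<open>N\<close> half-open arcs, numbered by \<open>c\<close>.
\<close>

lemma pigeonhole_arcs:
  fixes \<theta> :: "nat \<Rightarrow> real"
  assumes "0 < N" "\<And>j. j \<le> N \<Longrightarrow> 0 \<le> \<theta> j \<and> \<theta> j < 2 * pi"
  obtains j k where "j < k" "k \<le> N" "\<bar>\<theta> j - \<theta> k\<bar> \<le> 2 * pi / N"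
proof -
  define c where "c = (\<lambda>j. nat \<lfloor>real N * \<theta> j / (2 * pi)\<rfloor>)"
  have c: "real (c j) \<le> real N * \<theta> j / (2 * pi)" "real N * \<theta> j / (2 * pi) < real (c j) + 1" "c j < N"
    if "j \<le> N" for j
  proof -
    have nn: "0 \<le> real N * \<theta> j / (2 * pi)" 
      using assms(2)[OF that] by simp
    then show 1: "real (c j) \<le> real N * \<theta> j / (2 * pi)" "real N * \<theta> j / (2 * pi) < real (c j) + 1"
      unfolding c_def by linarith+
    have "real N * \<theta> j / (2 * pi) < real N"
      using assms(1) assms(2)[OF that] by (simp add: field_simps)
    with 1 show "c j < N" by linarith
  qed
  have "c ` {..N} \<subseteq> {..<N}"
    using c(3) by auto
  then have "card (c ` {..N}) < card {..N}"
    using card_mono[of "{..<N}" "c ` {..N}"] by simp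
  then have "\<not> inj_on c {..N}"
    using pigeonhole by blast
  then obtain j k where jk: "j \<le> N" "k \<le> N" "j \<noteq> k" "c j = c k"
    by (auto simp: inj_on_def)
  have *: "\<bar>\<theta> j - \<theta> k\<bar> \<le> 2 * pi / N"
  proof -
    have "\<bar>real N * \<theta> j / (2 * pi) - real N * \<theta> k / (2 * pi)\<bar> \<le> 1"
      using c(1,2)[OF jk(1)] c(1,2)[OF jk(2)] jk(4) by (smt (verit))
    also have "real N * \<theta> j / (2 * pi) - real N * \<theta> k / (2 * pi) = real N / (2 * pi) * (\<theta> j - \<theta> k)"
      by (simp add: right_diff_distrib)
    finally have "real N / (2 * pi) * \<bar>\<theta> j - \<theta> k\<bar> \<le> 1"
      by (simp add: abs_mult)
    then show ?thesis
      using assms(1) by (simp add: field_simps)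
  qed
  show thesis
    using that[of j k] that[of k j] jk * by (cases "j < k") (auto simp: abs_minus_commute)
qed

text \<open>
  The factor \<open>K\<close> enters twice: once in the distance of the chosen points from the tip, and once in the
  distance between two of them.
\<close>

theorem conical_angle_le:
  assumes E: "conical \<beta> E" and D: "conical \<alpha> D" and "0 < K" "0 < \<rho>"
    and G0: "G 0 = 0"
    and lip: "\<And>p q. cmod p < \<rho> \<Longrightarrow> cmod q < \<rho> \<Longrightarrow> D (G p) (G q) \<le> K * E p q"
    and colip: "\<And>p q. cmod p < \<rho> \<Longrightarrow> cmod q < \<rho> \<Longrightarrow> E p q \<le> K * D (G p) (G q)"
  shows "\<beta> \<le> K\<^sup>2 * \<alpha>"
proof -
  interpret E: conical \<beta> E by (rule E)
  interpret D: conical \<alpha> D by (rule D)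
  define \<rho>' where "\<rho>' = \<rho> / 2"
  have \<rho>': "0 < \<rho>'" "\<rho>' < \<rho>"
    using \<open>0 < \<rho>\<close> by (auto simp: \<rho>'_def)
  define r where "r = \<rho>' / K"
  define s where "s = r / K"
  have rs: "0 < r" "0 < s"
    using \<rho>' \<open>0 < K\<close> by (auto simp: r_def s_def)
  have cn: "cmod (of_real t * cis \<theta>) = t" if "0 \<le> t" for t \<theta>
    using that by (simp add: norm_mult)
  have up: "E 0 (of_real t * cis \<theta>) \<le> t" if "0 \<le> t" for t \<theta>
    using E.radial_le[of 0 t \<theta>] that by simp
  have D0: "D 0 z \<le> cmod z" for z
    using D.radial_le[of 0 "cmod z" "Arg z"] rcis_cmod_Arg[of z] by (simp add: rcis_def)
  \<comment> \<open>every ray from the tip is sent across the circle of radius \<open>r\<close>\<close>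
  have hit: "\<exists>t\<ge>s. t < \<rho> \<and> cmod (G (of_real t * cis \<theta>)) = r" for \<theta>
  proof -
    define f where "f = (\<lambda>t. cmod (G (of_real t * cis \<theta>)))"
    have "K-lipschitz_on {0..\<rho>'} f"
    proof (rule lipschitz_onI)
      fix t t' assume t: "t \<in> {0..\<rho>'}" "t' \<in> {0..\<rho>'}"
      have "dist (f t) (f t') \<le> D (G (of_real t * cis \<theta>)) (G (of_real t' * cis \<theta>))"
        unfolding f_def dist_real_def by (rule D.radius_le)
      also have "\<dots> \<le> K * E (of_real t * cis \<theta>) (of_real t' * cis \<theta>)"
        using t \<rho>' by (intro lip) (auto simp: norm_mult)
      also have "\<dots> \<le> K * dist t t'"
        using t \<open>0 < K\<close> by (intro mult_left_mono) (auto simp: dist_real_def E.radial_le)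
      finally show "dist (f t) (f t') \<le> K * dist t t'" .
    qed (use \<open>0 < K\<close> in simp)
    then have cont: "continuous_on {0..\<rho>'} f"
      by (rule lipschitz_on_continuous_on)
    have "\<rho>' \<le> E 0 (of_real \<rho>' * cis \<theta>)"
      using E.radius_le[of 0 "of_real \<rho>' * cis \<theta>"] \<rho>' by (simp add: norm_mult)
    also have "\<dots> \<le> K * D (G 0) (G (of_real \<rho>' * cis \<theta>))"
      using \<rho>' by (intro colip) (auto simp: norm_mult)
    also have "\<dots> \<le> K * f \<rho>'"
      using D0[of "G (of_real \<rho>' * cis \<theta>)"] \<open>0 < K\<close> by (simp add: G0 f_def)
    finally have "r \<le> f \<rho>'"
      using \<open>0 < K\<close> by (simp add: r_def field_simps)
    moreover have "f 0 \<le> r"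
      using rs by (simp add: f_def G0)
    ultimately obtain t where t: "0 \<le> t" "t \<le> \<rho>'" "f t = r"
      using IVT'[OF _ _ _ cont] \<rho>' by force
    have "r \<le> D (G 0) (G (of_real t * cis \<theta>))"
      using D.radius_le[of 0 "G (of_real t * cis \<theta>)"] t rs by (simp add: G0 f_def)
    also have "\<dots> \<le> K * E 0 (of_real t * cis \<theta>)"
      using t \<rho>' by (intro lip) (auto simp: norm_mult)
    also have "\<dots> \<le> K * t"
      using up[OF t(1)] \<open>0 < K\<close> by simp
    finally have "s \<le> t"
      using \<open>0 < K\<close> by (simp add: s_def field_simps)
    then show ?thesis
      using t \<rho>' by (auto simp: f_def)
  qed
  \<comment> \<open>the bound on \<open>N\<close> makes two of the points so close that a curve between them of
    comparable length cannot descend to radius \<open>m\<close>\<close>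
  have count: "\<beta> * m * real N \<le> K * \<alpha> * r * (real N + 1)"
    if m: "0 < m" and N: "0 < N" "K * \<alpha> * r < real N * (s - m)" for m N
  proof -
    define \<theta> where "\<theta> = (\<lambda>k. 2 * pi * real k / real (Suc N))"
    have "\<forall>k. \<exists>t. s \<le> t \<and> t < \<rho> \<and> cmod (G (of_real t * cis (\<theta> k))) = r"
      using hit by blast
    then obtain t where t: "\<And>k. s \<le> t k" "\<And>k. t k < \<rho>" "\<And>k. cmod (G (of_real (t k) * cis (\<theta> k))) = r"
      by metis
    define z where "z = (\<lambda>k. of_real (t k) * cis (\<theta> k))"
    have tpos: "0 < t k" for k
      using rs t(1)[of k] by simp
    have z: "cmod (z k) = t k" "cmod (G (z k)) = r" for k
      using tpos[of k] t(3)[of k] by (simp_all add: z_def norm_mult)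
    define \<phi> where "\<phi> = (\<lambda>k. Arg2pi (G (z k)))"
    have Gz: "G (z k) = of_real r * cis (\<phi> k)" for k
      using Arg2pi_eq[of "G (z k)"] z(2)[of k] by (simp add: \<phi>_def cis_conv_exp)
    obtain j k where jk: "j < k" "k \<le> N" "\<bar>\<phi> j - \<phi> k\<bar> \<le> 2 * pi / N"
      using pigeonhole_arcs[of N \<phi>] N(1) Arg2pi_ge_0 Arg2pi_lt_2pi unfolding \<phi>_def by metis
    have "D (G (z j)) (G (z k)) \<le> \<alpha> / (2 * pi) * r * \<bar>\<phi> j - \<phi> k\<bar>"
      unfolding Gz using rs by (intro D.arc_le) simp
    also have "\<dots> \<le> \<alpha> / (2 * pi) * r * (2 * pi / N)"
      using jk(3) rs D.angle_pos by (intro mult_left_mono) auto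
    finally have "K * D (G (z j)) (G (z k)) \<le> K * (\<alpha> * r / N)"
      using \<open>0 < K\<close> by (intro mult_left_mono) auto
    moreover have "E (z j) (z k) \<le> K * D (G (z j)) (G (z k))"
      using t(2) z(1) by (intro colip) auto
    ultimately have le: "E (z j) (z k) \<le> K * \<alpha> * r / N"
      by simp
    have lt: "K * \<alpha> * r / N < s - m"
      using N by (simp add: field_simps)
    moreover have "0 \<le> K * \<alpha> * r / N"
      using \<open>0 < K\<close> D.angle_pos rs by simp
    ultimately have "m \<le> t j" "K * \<alpha> * r / N < t j - m"
      using t(1)[of j] by linarith+
    then have ang: "\<beta> / (2 * pi) * m * \<bar>Arg (z k / z j)\<bar> \<le> K * \<alpha> * r / N"
      using E.angle_le[OF m, of "z j" "z k"] le z(1)[of j] by (auto simp: min_def split: if_splits)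
    have "z k / z j = of_real (t k / t j) * (cis (\<theta> k) / cis (\<theta> j))"
      by (simp add: z_def)
    then have "Arg (z k / z j) = Arg (cis (\<theta> k) / cis (\<theta> j))"
      using tpos[of j] tpos[of k] by (simp only: Arg_times_of_real divide_pos_pos)
    then have "2 * pi / real (Suc N) \<le> \<bar>Arg (z k / z j)\<bar>"
      using abs_Arg_cis_equispaced[OF jk(1), of "Suc N"] jk(2) by (simp add: \<theta>_def)
    then have "\<beta> / (2 * pi) * m * (2 * pi / real (Suc N)) \<le> \<beta> / (2 * pi) * m * \<bar>Arg (z k / z j)\<bar>"
      using m E.angle_pos by (intro mult_left_mono) auto
    with ang have "\<beta> * m / real (Suc N) \<le> K * \<alpha> * r / N"
      by simp
    then show ?thesis
      using N(1) by (simp add: divide_simps add.commute split: if_splits)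
  qed
  have bound: "\<beta> * m \<le> K * \<alpha> * r" if m: "0 < m" "m < s" for m
  proof (rule ccontr)
    assume "\<not> ?thesis"
    then have pos: "0 < \<beta> * m - K * \<alpha> * r"
      by simp
    obtain N :: nat where N: "max (K * \<alpha> * r / (s - m)) (K * \<alpha> * r / (\<beta> * m - K * \<alpha> * r)) < N"
      using reals_Archimedean2 by blast
    have "0 \<le> K * \<alpha> * r / (s - m)"
      using \<open>0 < K\<close> D.angle_pos rs m by simp
    then have "0 < N"
      using N by (cases N) auto
    moreover have "K * \<alpha> * r < real N * (s - m)" "K * \<alpha> * r < real N * (\<beta> * m - K * \<alpha> * r)"
      using N m pos by (simp_all add: pos_divide_less_eq)
    ultimately show False
      using count[OF m(1), of N] by (simp add: algebra_simps)
  qed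
  have "\<beta> * s \<le> K * \<alpha> * r"
  proof (rule tendsto_upperbound)
    show "((\<lambda>m. \<beta> * m) \<longlongrightarrow> \<beta> * s) (at_left s)"
      by (intro tendsto_intros)
    show "\<forall>\<^sub>F m in at_left s. \<beta> * m \<le> K * \<alpha> * r"
      using bound rs by (auto simp: eventually_at_left_field intro!: exI[of _ 0])
  qed simp
  then show ?thesis
    using rs \<open>0 < K\<close> by (simp add: s_def field_simps power2_eq_square)
qed

text \<open>
  The maps \<open>F\<close> and \<open>G\<close> represent a homeomorphism and its inverse in coordinates. The angles of the cone
  and of the Euclidean plane are compared through each of them, once the target of \<open>F\<close> is known to be a
  plane.
\<close>

lemma cone_angle_bounds:
  fixes F :: "complex \<Rightarrow> 'e::euclidean_space" and G :: "'e \<Rightarrow> complex"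
  assumes \<alpha>: "0 < \<alpha>" and pos: "0 < k" "0 < r" "0 < \<rho>" and F0: "F 0 = 0" and G0: "G 0 = 0"
    and F_lip: "\<And>p q. cmod p < r \<Longrightarrow> cmod q < r \<Longrightarrow> dist (F p) (F q) \<le> k * cone_dist \<alpha> p q"
    and F_colip: "\<And>p q. cmod p < r \<Longrightarrow> cmod q < r \<Longrightarrow> cone_dist \<alpha> p q \<le> k * dist (F p) (F q)"
    and G_lip: "\<And>x y. norm x < \<rho> \<Longrightarrow> norm y < \<rho> \<Longrightarrow> cone_dist \<alpha> (G x) (G y) \<le> k * dist x y"
    and G_colip: "\<And>x y. norm x < \<rho> \<Longrightarrow> norm y < \<rho> \<Longrightarrow> dist x y \<le> k * cone_dist \<alpha> (G x) (G y)"
    and FG: "\<And>x. norm x < \<rho> \<Longrightarrow> cmod (G x) < r \<Longrightarrow> F (G x) = x"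
  shows "2 * pi \<le> k\<^sup>2 * \<alpha> \<and> \<alpha> \<le> k\<^sup>2 * (2 * pi)"
proof -
  interpret cone: conical \<alpha> "cone_dist \<alpha>"
    by (rule conical_cone_dist[OF \<alpha>])
  define m where "m = max 1 (\<alpha> / (2 * pi))"
  have m: "1 \<le> m" "cone_dist \<alpha> p q \<le> m * dist p q" for p q
    using cone_dist_le_segment[OF \<alpha>, of p q] by (simp_all add: m_def dist_norm)
  have "(k * m)-lipschitz_on (ball 0 r) F"
  proof (rule lipschitz_onI)
    fix p q :: complex assume "p \<in> ball 0 r" "q \<in> ball 0 r"
    then have "dist (F p) (F q) \<le> k * cone_dist \<alpha> p q"
      using F_lip by simp
    also have "\<dots> \<le> k * (m * dist p q)"
      using pos m by (intro mult_left_mono) auto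
    finally show "dist (F p) (F q) \<le> k * m * dist p q"
      by (simp add: mult.assoc)
  qed (use pos m in auto)
  then have F_cont: "continuous_on (ball 0 r) F"
    by (rule lipschitz_on_continuous_on)
  have F_inj: "inj_on F (ball 0 r)"
  proof (rule inj_onI)
    fix p q assume "p \<in> ball 0 r" "q \<in> ball 0 r" "F p = F q"
    then show "p = q"
      using F_colip[of p q] by (intro cone.eq_if_dist_nonpos) simp
  qed
  have "DIM(complex) \<le> DIM('e)"
    using invariance_of_dimension[OF F_cont _ F_inj] pos(2) by simp
  \<comment> \<open>the assumptions control \<open>G\<close> in the distance of the cone only. It is continuous
    because it inverts \<open>F\<close>, which is a homeomorphism from a compact disk to its
    image.\<close>
  moreover have "DIM('e) \<le> DIM(complex)"
  proof -
    define \<rho>' where "\<rho>' = min \<rho> (r / (2 * k))"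
    have \<rho>': "0 < \<rho>'" "\<rho>' \<le> \<rho>" "k * \<rho>' \<le> r / 2"
      using pos by (auto simp: \<rho>'_def min_def field_simps)
    have G_small: "G x \<in> cball 0 (r / 2)" if "x \<in> ball 0 \<rho>'" for x
    proof -
      have "cmod (G x) \<le> cone_dist \<alpha> (G x) (G 0)"
        using cone.radius_le[of "G x" 0] by (simp add: G0)
      also have "\<dots> \<le> k * dist x 0"
        using that \<rho>' pos by (intro G_lip) auto
      also have "\<dots> \<le> k * \<rho>'"
        using that pos by (intro mult_left_mono) auto
      finally show ?thesis
        using \<rho>' by simp
    qed
    have sub: "cball 0 (r / 2) \<subseteq> ball (0::complex) r"
      using pos by auto
    define J where "J = inv_into (cball 0 (r / 2)) F"
    have FGx: "F (G x) = x" if "x \<in> ball 0 \<rho>'" for x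
      using that \<rho>' G_small[OF that] sub by (intro FG) auto
    have J: "J x = G x" if "x \<in> ball 0 \<rho>'" for x
      using inv_into_f_f[OF inj_on_subset[OF F_inj sub] G_small[OF that]] FGx[OF that] by (simp add: J_def)
    have "continuous_on (F ` cball 0 (r / 2)) J"
      using inj_on_subset[OF F_inj sub] unfolding J_def
      by (intro continuous_on_inv continuous_on_subset[OF F_cont sub]) auto
    then have "continuous_on (ball 0 \<rho>') J"
      by (rule continuous_on_subset) (metis FGx G_small image_eqI subsetI)
    then have "continuous_on (ball 0 \<rho>') G"
      by (rule continuous_on_eq[OF _ J])
    moreover have "inj_on G (ball 0 \<rho>')"
      using FGx by (rule inj_on_inverseI)
    ultimately show ?thesis
      using invariance_of_dimension[of "ball 0 \<rho>'" G] \<rho>'(1) by simp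
  qed
  ultimately have dim: "dim (UNIV :: complex set) = dim (UNIV :: 'e set)"
    by simp
  obtain S :: "complex \<Rightarrow> 'e" and T :: "'e \<Rightarrow> complex" where
    ST: "linear S" "linear T" "\<And>z. norm (S z) = norm z" "\<And>x. norm (T x) = norm x"
    using isometries_subspaces[OF subspace_UNIV subspace_UNIV dim] by (metis UNIV_I)
  have S_dist: "dist (S p) (S q) = dist p q" for p q
    using ST(3)[of "p - q"] by (simp add: dist_norm linear_diff[OF ST(1)])
  have T_dist: "dist (T x) (T y) = dist x y" for x y
    using ST(4)[of "x - y"] by (simp add: dist_norm linear_diff[OF ST(2)])
  show ?thesis
  proof
    show "2 * pi \<le> k\<^sup>2 * \<alpha>"
    proof (rule conical_angle_le[OF conical_dist conical_cone_dist[OF \<alpha>] pos(1,3), of "G \<circ> S"])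
      fix p q :: complex assume "cmod p < \<rho>" "cmod q < \<rho>"
      then show "cone_dist \<alpha> ((G \<circ> S) p) ((G \<circ> S) q) \<le> k * dist p q"
        and "dist p q \<le> k * cone_dist \<alpha> ((G \<circ> S) p) ((G \<circ> S) q)"
        using G_lip[of "S p" "S q"] G_colip[of "S p" "S q"] by (simp_all add: ST S_dist)
    qed (simp add: linear_0[OF ST(1)] G0)
    show "\<alpha> \<le> k\<^sup>2 * (2 * pi)"
    proof (rule conical_angle_le[OF conical_cone_dist[OF \<alpha>] conical_dist pos(1,2), of "T \<circ> F"])
      fix p q :: complex assume "cmod p < r" "cmod q < r"
      then show "dist ((T \<circ> F) p) ((T \<circ> F) q) \<le> k * cone_dist \<alpha> p q"
        and "cone_dist \<alpha> p q \<le> k * dist ((T \<circ> F) p) ((T \<circ> F) q)"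
        using F_lip[of p q] F_colip[of p q] by (simp_all add: T_dist)
    qed (simp add: linear_0[OF ST(2)] F0)
  qed
qed

section \<open>Positive definite forms\<close>

text \<open>
  Gram-Schmidt orthogonalization with respect to \<open>B\<close>.
\<close>

lemma orthonormal_basis_for_form:
  fixes B :: "'e::euclidean_space \<Rightarrow> 'e \<Rightarrow> real"
  assumes B: "bilinear B" and sym: "\<And>u v. B u v = B v u" and pos: "\<And>v. v \<noteq> 0 \<Longrightarrow> 0 < B v v"
    and "finite S"
  shows "\<exists>T. finite T \<and> span T = span S \<and> (\<forall>x\<in>T. \<forall>y\<in>T. B x y = (if x = y then 1 else 0))"
  using \<open>finite S\<close>
proof (induction S)
  case empty
  then show ?case by (intro exI[of _ "{}"]) auto
next
  case (insert x S)
  interpret l: linear "\<lambda>u. B u v" for v using B by (simp add: bilinear_def)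
  interpret r: linear "\<lambda>v. B u v" for u using B by (simp add: bilinear_def)
  obtain T where T: "finite T" "span T = span S" "\<And>x y. x \<in> T \<Longrightarrow> y \<in> T \<Longrightarrow> B x y = (if x = y then 1 else 0)"
    using insert by blast
  define y where "y = (\<Sum>b\<in>T. B x b *\<^sub>R b)"
  define w where "w = x - y"
  have y: "y \<in> span T"
    unfolding y_def by (intro span_sum span_scale span_base)
  have orth: "B w b = 0" if "b \<in> T" for b
  proof -
    have "B y b = (\<Sum>a\<in>T. B x a * (if a = b then 1 else 0))"
      unfolding y_def l.sum l.scaleR using T(3) that by (intro sum.cong) auto
    also have "\<dots> = B x b"
      using T(1) that by (simp add: if_distrib cong: if_cong)
    finally show ?thesis
      by (simp add: w_def l.diff)
  qed
  have sp: "span (insert x S) = span (insert w T)"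
  proof -
    have "span (insert x S) = span (insert x T)"
      using T(2) by (metis span_insert)
    also have "\<dots> = span (insert w T)"
      using y by (simp add: w_def eq_span_insert_eq)
    finally show ?thesis .
  qed
  show ?case
  proof (cases "w = 0")
    case True
    then show ?thesis
      using T sp by (intro exI[of _ T]) (auto simp: span_insert_0)
  next
    case False
    define e where "e = w /\<^sub>R sqrt (B w w)"
    have Bw: "0 < B w w" using pos False by blast
    have "B e e = 1"
      using Bw by (simp add: e_def l.scaleR r.scaleR divide_simps)
    moreover have eT: "B e b = 0" "B b e = 0" if "b \<in> T" for b
      using orth[OF that] sym[of b e] by (simp_all add: e_def l.scaleR)
    moreover have "e \<notin> T"
      using eT(1)[of e] \<open>B e e = 1\<close> by auto
    moreover have "span (insert e T) = span (insert w T)"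
    proof (rule antisym)
      have "w = sqrt (B w w) *\<^sub>R e"
        using Bw by (simp add: e_def)
      then have "w \<in> span (insert e T)"
        by (metis insertI1 span_base span_scale)
      then show "span (insert w T) \<subseteq> span (insert e T)"
        by (intro span_minimal) (auto intro: span_base)
      have "e \<in> span (insert w T)"
        unfolding e_def by (intro span_scale span_base) simp
      then show "span (insert e T) \<subseteq> span (insert w T)"
        by (intro span_minimal) (auto intro: span_base)
    qed
    ultimately show ?thesis
      using T(1,3) sp by (intro exI[of _ "insert e T"] conjI ballI) (simp_all split: if_splits, metis+)
  qed
qed

text \<open>
  The coordinates with respect to a \<open>B\<close>-orthonormal basis turn \<open>B\<close> into the standard inner product.
  They are placed on distinct standard basis vectors.
\<close>

lemma positive_form_eq_norm_linear:
  fixes B :: "'e::euclidean_space \<Rightarrow> 'e \<Rightarrow> real"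
  assumes B: "bilinear B" and sym: "\<And>u v. B u v = B v u" and pos: "\<And>v. v \<noteq> 0 \<Longrightarrow> 0 < B v v"
  obtains L :: "'e \<Rightarrow> 'e" where "linear L" "bij L" "\<And>u. B u u = (norm (L u))\<^sup>2"
proof -
  interpret l: linear "\<lambda>u. B u v" for v using B by (simp add: bilinear_def)
  interpret r: linear "\<lambda>v. B u v" for u using B by (simp add: bilinear_def)
  obtain T where T: "finite T" "span T = UNIV" "\<And>x y. x \<in> T \<Longrightarrow> y \<in> T \<Longrightarrow> B x y = (if x = y then 1 else 0)"
    using orthonormal_basis_for_form[OF B sym pos, of Basis] by auto
  have coeff: "B (\<Sum>a\<in>T. k a *\<^sub>R a) b = k b" if "b \<in> T" for k b
  proof -
    have "B (\<Sum>a\<in>T. k a *\<^sub>R a) b = (\<Sum>a\<in>T. k a * (if a = b then 1 else 0))"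
      unfolding l.sum l.scaleR using T(3) that by (intro sum.cong) auto
    also have "\<dots> = k b"
      using T(1) that by (simp add: if_distrib cong: if_cong)
    finally show ?thesis .
  qed
  have expand: "u = (\<Sum>b\<in>T. B u b *\<^sub>R b)" for u
  proof -
    have "u \<in> span T" using T(2) by simp
    then obtain k where "u = (\<Sum>b\<in>T. k b *\<^sub>R b)"
      using span_finite[OF T(1)] by auto
    then show ?thesis
      using coeff by (metis (no_types, lifting) sum.cong)
  qed
  have "independent T"
  proof (rule independent_if_scalars_zero[OF T(1)])
    fix k x assume "(\<Sum>b\<in>T. k b *\<^sub>R b) = 0" "x \<in> T"
    then show "k x = 0"
      using coeff[of x k] by (simp add: l.zero)
  qed
  then have "card T \<le> card (Basis :: 'e set)"
    using independent_bound by blast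
  then obtain e where e: "e ` T \<subseteq> (Basis :: 'e set)" "inj_on e T"
    using card_le_inj[OF T(1) finite_Basis] by blast
  define L where "L = (\<lambda>u. \<Sum>b\<in>T. B u b *\<^sub>R e b)"
  have L: "linear L"
    unfolding L_def by (intro linear_compose_sum ballI) (auto intro!: linearI simp: l.add l.scaleR scaleR_left_distrib)
  have norm: "B u u = (norm (L u))\<^sup>2" for u
  proof -
    have "B u u = B u (\<Sum>b\<in>T. B u b *\<^sub>R b)"
      using expand[of u] by simp
    also have "\<dots> = (\<Sum>b\<in>T. (B u b)\<^sup>2)"
      by (simp add: r.sum r.scaleR power2_eq_square)
    also have "\<dots> = (\<Sum>b\<in>T. (norm (B u b *\<^sub>R e b))\<^sup>2)"
      using e(1) by (intro sum.cong) auto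
    also have "\<dots> = (norm (L u))\<^sup>2"
      unfolding L_def
    proof (rule norm_sum_Pythagorean[symmetric, OF T(1)])
      show "pairwise (\<lambda>i j. orthogonal (B u i *\<^sub>R e i) (B u j *\<^sub>R e j)) T"
      proof (rule pairwiseI)
        fix i j assume ij: "i \<in> T" "j \<in> T" "i \<noteq> j"
        then have "e i \<in> Basis" "e j \<in> Basis" "e i \<noteq> e j"
          using e by (auto dest: inj_onD)
        then show "orthogonal (B u i *\<^sub>R e i) (B u j *\<^sub>R e j)"
          by (simp add: orthogonal_def inner_not_same_Basis)
      qed
    qed
    finally show ?thesis .
  qed
  have "inj L"
    unfolding linear_injective_0[OF L] using norm pos by (metis norm_zero order_less_irrefl zero_power2)
  moreover have "surj L"
    using linear_injective_imp_surjective[OF L \<open>inj L\<close>] by simp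
  ultimately show thesis
    using that[OF L _ norm] by (simp add: bij_def)
qed

lemma bilinear_expand:
  fixes B :: "'e::euclidean_space \<Rightarrow> 'e \<Rightarrow> real" and u v :: 'e
  assumes "bilinear B"
  shows "B u v = (\<Sum>i\<in>Basis. \<Sum>j\<in>Basis. (u \<bullet> i) * (v \<bullet> j) * B i j)"
proof -
  interpret l: linear "\<lambda>a. B a b" for b using assms by (simp add: bilinear_def)
  interpret r: linear "\<lambda>b. B a b" for a using assms by (simp add: bilinear_def)
  have left: "B (\<Sum>i\<in>Basis. (u \<bullet> i) *\<^sub>R i) w = (\<Sum>i\<in>Basis. (u \<bullet> i) * B i w)" for w
    by (simp only: l.sum l.scaleR real_scaleR_def)
  have right: "B w (\<Sum>j\<in>Basis. (v \<bullet> j) *\<^sub>R j) = (\<Sum>j\<in>Basis. (v \<bullet> j) * B w j)" for w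
    by (simp only: r.sum r.scaleR real_scaleR_def)
  have "B u v = (\<Sum>i\<in>Basis. (u \<bullet> i) * B i v)"
    using left[of v] by (simp only: euclidean_representation)
  also have "\<dots> = (\<Sum>i\<in>Basis. (u \<bullet> i) * (\<Sum>j\<in>Basis. (v \<bullet> j) * B i j))"
    using right by (simp only: euclidean_representation)
  finally show ?thesis
    by (simp only: sum_distrib_left mult.assoc)
qed

section \<open>Charts and curves in a Riemannian manifold\<close>

context smooth_manifold begin

lemma chart_subset: "(U, \<phi>) \<in> A \<Longrightarrow> U \<subseteq> topspace M"
  using chart openin_subset by blast

lemma chart_inj: "(U, \<phi>) \<in> A \<Longrightarrow> inj_on \<phi> U"
  using chart[of U \<phi>] chart_subset[of U \<phi>]
  by (metis homeomorphic_imp_injective_map topspace_subtopology_subset)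

lemma chart_continuous:
  "(U, \<phi>) \<in> A \<Longrightarrow> continuous_map (subtopology M U) euclidean \<phi>"
  using chart[of U \<phi>] homeomorphic_imp_continuous_map continuous_map_in_subtopology by blast

lemma chart_inverse_continuous:
  assumes "(U, \<phi>) \<in> A"
  shows "continuous_map (top_of_set (\<phi> ` U)) M (inv_into U \<phi>)"
proof -
  obtain h where h: "homeomorphic_maps (subtopology M U) (top_of_set (\<phi> ` U)) \<phi> h"
    using chart[OF assms] homeomorphic_map_maps by blast
  have "continuous_map (top_of_set (\<phi> ` U)) M h"
    using h by (auto simp: homeomorphic_maps_def continuous_map_in_subtopology)
  moreover have "h x = inv_into U \<phi> x" if "x \<in> \<phi> ` U" for x
    using h that chart_inj[OF assms] chart_subset[OF assms] by (auto simp: homeomorphic_maps_def)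
  ultimately show ?thesis
    by (auto intro: continuous_map_eq)
qed

lemma transition_C1:
  assumes "(U, \<phi>) \<in> A" "(V, \<psi>) \<in> A"
  shows "x \<in> \<phi> ` (U \<inter> V) \<Longrightarrow>
      (\<psi> \<circ> inv_into U \<phi> has_derivative frechet_derivative (\<psi> \<circ> inv_into U \<phi>) (at x)) (at x)"
    and "continuous_on (\<phi> ` (U \<inter> V)) (\<lambda>x. frechet_derivative (\<psi> \<circ> inv_into U \<phi>) (at x) v)"
proof -
  have "Ck_on (Suc 0) (\<phi> ` (U \<inter> V)) (\<psi> \<circ> inv_into U \<phi>)"
    using smooth_transition[OF assms] unfolding smooth_on_def by blast
  then show "x \<in> \<phi> ` (U \<inter> V) \<Longrightarrow>
      (\<psi> \<circ> inv_into U \<phi> has_derivative frechet_derivative (\<psi> \<circ> inv_into U \<phi>) (at x)) (at x)"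
    and "continuous_on (\<phi> ` (U \<inter> V)) (\<lambda>x. frechet_derivative (\<psi> \<circ> inv_into U \<phi>) (at x) v)"
    by (auto simp: frechet_derivative_works)
qed

lemma chart_at:
  assumes "p \<in> topspace M"
  obtains U \<phi> where "(U, \<phi>) \<in> A" "p \<in> U"
  using assms charts_cover by fastforce

end

lemma path_preimage_open:
  assumes "pathin M \<gamma>" "openin M W"
  shows "open {s \<in> {0<..<1}. \<gamma> s \<in> W}"
proof -
  have "openin (top_of_set {0..1}) {s \<in> {0..1}. \<gamma> s \<in> W}"
    using openin_continuous_map_preimage[of "top_of_set {0..1::real}" M \<gamma> W] assms by (simp add: pathin_def)
  then obtain O' where "open O'" and O': "{s \<in> {0..1}. \<gamma> s \<in> W} = {0..1} \<inter> O'"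
    unfolding openin_open by blast
  have "{s \<in> {0<..<1}. \<gamma> s \<in> W} = {0<..<1} \<inter> {s \<in> {0..1}. \<gamma> s \<in> W}"
    by auto
  also have "\<dots> = {0<..<1} \<inter> O'"
    unfolding O' by auto
  finally show ?thesis
    using \<open>open O'\<close> by (simp only: open_Int open_greaterThanLessThan)
qed

lemma path_near:
  assumes "pathin M \<gamma>" "openin M W" "t \<in> {0..1}" "\<gamma> t \<in> W"
  obtains \<delta> where "0 < \<delta>" "\<And>s. s \<in> {0..1} \<Longrightarrow> dist s t < \<delta> \<Longrightarrow> \<gamma> s \<in> W"
proof -
  have "openin (top_of_set {0..1}) {s \<in> {0..1}. \<gamma> s \<in> W}"
    using openin_continuous_map_preimage[of "top_of_set {0..1::real}" M \<gamma> W] assms by (simp add: pathin_def)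
  then obtain \<delta> where "0 < \<delta>" "\<And>s. s \<in> {0..1} \<Longrightarrow> dist s t < \<delta> \<Longrightarrow> s \<in> {s \<in> {0..1}. \<gamma> s \<in> W}"
    using assms(3,4) unfolding openin_euclidean_subtopology_iff by blast
  then show thesis
    using that by blast
qed

lemma path_in_chart_continuous:
  assumes "pathin M \<gamma>" "continuous_map (subtopology M U) euclidean \<phi>" "T \<subseteq> {0..1}" "\<gamma> ` T \<subseteq> U"
  shows "continuous_on T (\<phi> \<circ> \<gamma>)"
proof -
  have "continuous_map (top_of_set T) (subtopology M U) \<gamma>"
    using assms unfolding pathin_def
    by (metis continuous_map_from_subtopology_mono continuous_map_into_subtopology image_subset_iff_funcset topspace_euclidean_subtopology)
  then have "continuous_map (top_of_set T) euclidean (\<phi> \<circ> \<gamma>)"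
    using assms(2) continuous_map_compose by blast
  then show ?thesis
    by simp
qed

context riemannian_manifold begin

lemma metric_nonneg: "(U, \<phi>) \<in> A \<Longrightarrow> p \<in> U \<Longrightarrow> 0 \<le> g (U, \<phi>) p v v"
  using metric_pos[of U \<phi> p v] bilinear_lzero[OF metric_bilinear, of U \<phi> p v] by (cases "v = 0") auto

lemma metric_coefficient_continuous:
  "(U, \<phi>) \<in> A \<Longrightarrow> continuous_on (\<phi> ` U) (\<lambda>x. g (U, \<phi>) (inv_into U \<phi> x) u v)"
  using metric_smooth[of U \<phi> u v] unfolding smooth_on_def by (metis Ck_on.simps(1))

lemma metric_continuous_along:
  assumes c: "(U, \<phi>) \<in> A" and "\<gamma> ` T \<subseteq> U" "continuous_on T (\<phi> \<circ> \<gamma>)" "continuous_on T D"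
  shows "continuous_on T (\<lambda>t. g (U, \<phi>) (\<gamma> t) (D t) (D t))"
proof -
  have "continuous_on T (\<lambda>t. g (U, \<phi>) (\<gamma> t) i j)" for i j
  proof -
    have "continuous_on T ((\<lambda>x. g (U, \<phi>) (inv_into U \<phi> x) i j) \<circ> (\<phi> \<circ> \<gamma>))"
      using assms(2) by (intro continuous_on_compose assms(3)
          continuous_on_subset[OF metric_coefficient_continuous[OF c]]) auto
    moreover have "inv_into U \<phi> (\<phi> (\<gamma> t)) = \<gamma> t" if "t \<in> T" for t
      using chart_inj[OF c] assms(2) that by (intro inv_into_f_f) auto
    ultimately show ?thesis
      by (simp cong: continuous_on_cong)
  qed
  then have "continuous_on T (\<lambda>t. \<Sum>i\<in>Basis. \<Sum>j\<in>Basis. (D t \<bullet> i) * (D t \<bullet> j) * g (U, \<phi>) (\<gamma> t) i j)"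
    by (intro continuous_intros assms(4))
  moreover have "g (U, \<phi>) (\<gamma> t) (D t) (D t) =
      (\<Sum>i\<in>Basis. \<Sum>j\<in>Basis. (D t \<bullet> i) * (D t \<bullet> j) * g (U, \<phi>) (\<gamma> t) i j)" if "t \<in> T" for t
    using metric_bilinear[OF c, of "\<gamma> t"] assms(2) that by (intro bilinear_expand) auto
  ultimately show ?thesis
    by (simp cong: continuous_on_cong)
qed

lemma chosen_chart:
  assumes "p \<in> topspace M"
  obtains V \<psi> where "(V, \<psi>) \<in> A" "p \<in> V" "(SOME c. c \<in> A \<and> p \<in> fst c) = (V, \<psi>)"
proof -
  have "\<exists>c. c \<in> A \<and> p \<in> fst c"
    using assms charts_cover by blast
  then have c: "(SOME c. c \<in> A \<and> p \<in> fst c) \<in> A \<and> p \<in> fst (SOME c. c \<in> A \<and> p \<in> fst c)"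
    by (rule someI_ex)
  show thesis
    by (rule that[of "fst (SOME c. c \<in> A \<and> p \<in> fst c)" "snd (SOME c. c \<in> A \<and> p \<in> fst c)"])
      (simp_all only: c prod.collapse)
qed

lemma speed_nonneg:
  assumes "pathin M \<gamma>" "t \<in> {0..1}"
  shows "0 \<le> riemannian_speed A g \<gamma> t"
proof -
  have "\<gamma> t \<in> topspace M"
    using assms unfolding pathin_def continuous_map by auto
  then obtain V \<psi> where V: "(V, \<psi>) \<in> A" "\<gamma> t \<in> V" "(SOME c. c \<in> A \<and> \<gamma> t \<in> fst c) = (V, \<psi>)"
    using chosen_chart by blast
  show ?thesis
    unfolding riemannian_speed_def V(3) Let_def using metric_nonneg[OF V(1,2)] by simp
qed

text \<open>
  The definition of the speed picks a chart that depends on \<open>t\<close>. The chain rule and the transformation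
  law of the metric tensor allow one chart to be used along a whole piece of the curve.
\<close>

lemma speed_eq:
  assumes \<gamma>: "pathin M \<gamma>" and t: "t \<in> {0<..<1}" and c: "(U, \<phi>) \<in> A" "\<gamma> t \<in> U"
    and v: "(\<phi> \<circ> \<gamma> has_vector_derivative v) (at t)"
  shows "riemannian_speed A g \<gamma> t = sqrt (g (U, \<phi>) (\<gamma> t) v v)"
proof -
  obtain V \<psi> where V: "(V, \<psi>) \<in> A" "\<gamma> t \<in> V" "(SOME c. c \<in> A \<and> \<gamma> t \<in> fst c) = (V, \<psi>)"
    using chosen_chart c chart_subset by blast
  define T where "T = frechet_derivative (\<psi> \<circ> inv_into U \<phi>) (at (\<phi> (\<gamma> t)))"
  have T: "(\<psi> \<circ> inv_into U \<phi> has_derivative T) (at ((\<phi> \<circ> \<gamma>) t))"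
    unfolding T_def o_apply[of \<phi>] using transition_C1(1)[OF c(1) V(1)] c(2) V(2) by blast
  have "((\<psi> \<circ> inv_into U \<phi>) \<circ> (\<phi> \<circ> \<gamma>) has_vector_derivative T v) (at t)"
    using diff_chain_at[OF v[unfolded has_vector_derivative_def] T]
    unfolding has_vector_derivative_def
    by (simp add: o_def linear_cmul[OF has_derivative_linear[OF T]])
  moreover have "open {s \<in> {0<..<1}. \<gamma> s \<in> U \<inter> V}"
    using path_preimage_open[OF \<gamma>] chart[OF c(1)] chart[OF V(1)] by blast
  ultimately have "(\<psi> \<circ> \<gamma> has_vector_derivative T v) (at t)"
  proof (rule has_vector_derivative_transform_within_open)
    show "t \<in> {s \<in> {0<..<1}. \<gamma> s \<in> U \<inter> V}"
      using t c(2) V(2) by simp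
  qed (use chart_inj[OF c(1)] in simp)
  then have "vector_derivative (\<psi> \<circ> \<gamma>) (at t) = T v"
    by (rule vector_derivative_at)
  moreover have "g (V, \<psi>) (\<gamma> t) (T v) (T v) = g (U, \<phi>) (\<gamma> t) v v"
    using c V T_def by (intro metric_tensor) auto
  ultimately show ?thesis
    unfolding riemannian_speed_def V(3) by simp
qed

lemma C1_piece_derivative:
  assumes \<gamma>: "pathin M \<gamma>" and c: "(U, \<phi>) \<in> A" and ab: "0 \<le> a" "b \<le> 1"
    and C1: "C1_on {t \<in> {a..b}. \<gamma> t \<in> U} (\<phi> \<circ> \<gamma>)"
  obtains D where "continuous_on {t \<in> {a..b}. \<gamma> t \<in> U} D"
    "\<And>t. t \<in> {a<..<b} \<Longrightarrow> \<gamma> t \<in> U \<Longrightarrow> (\<phi> \<circ> \<gamma> has_vector_derivative D t) (at t)"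
proof -
  obtain D where D: "continuous_on {t \<in> {a..b}. \<gamma> t \<in> U} D"
    "\<And>t. t \<in> {t \<in> {a..b}. \<gamma> t \<in> U} \<Longrightarrow>
      (\<phi> \<circ> \<gamma> has_vector_derivative D t) (at t within {t \<in> {a..b}. \<gamma> t \<in> U})"
    using C1 unfolding C1_on_def by blast
  define O' where "O' = {a<..<b} \<inter> {s \<in> {0<..<1}. \<gamma> s \<in> U}"
  have O': "open O'"
    unfolding O'_def using chart[OF c]
    by (intro open_Int open_greaterThanLessThan path_preimage_open[OF \<gamma>]) simp
  have "(\<phi> \<circ> \<gamma> has_vector_derivative D t) (at t)" if "t \<in> {a<..<b}" "\<gamma> t \<in> U" for t
  proof -
    have "t \<in> O'"
      using that ab by (auto simp: O'_def)
    moreover have "(\<phi> \<circ> \<gamma> has_vector_derivative D t) (at t within O')"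
      using that by (intro has_vector_derivative_within_subset[OF D(2)]) (auto simp: O'_def)
    ultimately show ?thesis
      using O' by (metis at_within_open)
  qed
  then show thesis
    using that D(1) by blast
qed

text \<open>
  No single chart covers the curve, but near each parameter value the speed can be computed in one chart,
  where it is continuous up to the end points of the smooth piece.
\<close>

lemma speed_integrable:
  assumes \<gamma>: "piecewise_C1_curve M A \<gamma>"
  shows "riemannian_speed A g \<gamma> integrable_on {0..1}"
proof (rule piecewise_integrable)
  show "piecewise (\<lambda>I. \<forall>(U, \<phi>)\<in>A. C1_on {t \<in> I. \<gamma> t \<in> U} (\<phi> \<circ> \<gamma>))"
    using \<gamma> unfolding piecewise_C1_curve_def by blast
  have path: "pathin M \<gamma>"
    using \<gamma> unfolding piecewise_C1_curve_def by blast
  fix a b :: real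
  assume ab: "0 \<le> a" "a < b" "b \<le> 1"
    and C1: "\<forall>(U, \<phi>)\<in>A. C1_on {t \<in> {a..b}. \<gamma> t \<in> U} (\<phi> \<circ> \<gamma>)"
  have "riemannian_speed A g \<gamma> integrable_on cbox a b"
  proof (rule integrable_on_little_subintervals, intro ballI)
    fix x assume x: "x \<in> cbox a b"
    then have "\<gamma> x \<in> topspace M"
      using path ab unfolding pathin_def continuous_map by auto
    then obtain U \<phi> where c: "(U, \<phi>) \<in> A" "\<gamma> x \<in> U"
      using chart_at by blast
    obtain \<delta> where \<delta>: "0 < \<delta>" "\<And>s. s \<in> {0..1} \<Longrightarrow> dist s x < \<delta> \<Longrightarrow> \<gamma> s \<in> U"
      using path_near[OF path _ _ c(2)] chart[OF c(1)] x ab by auto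
    obtain D where D: "continuous_on {t \<in> {a..b}. \<gamma> t \<in> U} D"
      "\<And>t. t \<in> {a<..<b} \<Longrightarrow> \<gamma> t \<in> U \<Longrightarrow> (\<phi> \<circ> \<gamma> has_vector_derivative D t) (at t)"
      using C1_piece_derivative[OF path c(1) ab(1,3)] C1 c(1) by blast
    have "riemannian_speed A g \<gamma> integrable_on cbox u v"
      if uv: "cbox u v \<subseteq> ball x \<delta>" "cbox u v \<subseteq> cbox a b" for u v
    proof (cases "u \<le> v")
      case True
      have sub: "{u..v} \<subseteq> {t \<in> {a..b}. \<gamma> t \<in> U}" and ab': "a \<le> u" "v \<le> b"
        using uv \<delta>(2) True ab by (auto simp: dist_commute subset_eq)
      then have U: "\<gamma> ` {u..v} \<subseteq> U" by auto
      have "continuous_on {u..v} (\<phi> \<circ> \<gamma>)"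
        using ab ab' by (intro path_in_chart_continuous[OF path chart_continuous[OF c(1)] _ U]) auto
      then have "continuous_on {u..v} (\<lambda>t. sqrt (g (U, \<phi>) (\<gamma> t) (D t) (D t)))"
        using metric_continuous_along[OF c(1) U] continuous_on_subset[OF D(1) sub]
        by (intro continuous_intros) auto
      then have "(\<lambda>t. sqrt (g (U, \<phi>) (\<gamma> t) (D t) (D t))) integrable_on {u..v}"
        by (rule integrable_continuous_real)
      moreover have "riemannian_speed A g \<gamma> t = sqrt (g (U, \<phi>) (\<gamma> t) (D t) (D t))"
        if "t \<in> {u..v} - {u, v}" for t
        using that ab ab' U by (intro speed_eq[OF path _ c(1)] D(2)) auto
      ultimately show ?thesis
        by (subst integrable_spike_finite_eq[of "{u, v}" _ _ "\<lambda>t. sqrt (g (U, \<phi>) (\<gamma> t) (D t) (D t))"]) auto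
    qed (simp add: integrable_on_empty)
    then show "\<exists>d>0. \<forall>u v. x \<in> cbox u v \<and> cbox u v \<subseteq> ball x d \<and> cbox u v \<subseteq> cbox a b \<longrightarrow>
        riemannian_speed A g \<gamma> integrable_on cbox u v"
      using \<delta>(1) by blast
  qed
  then show "riemannian_speed A g \<gamma> integrable_on {a..b}"
    by simp
qed

lemma curve_derivative_off_finite:
  assumes \<gamma>: "piecewise_C1_curve M A \<gamma>"
  obtains S where "finite S"
    "\<And>t U \<phi>. t \<in> {0..1} - S \<Longrightarrow> (U, \<phi>) \<in> A \<Longrightarrow> \<gamma> t \<in> U \<Longrightarrow>
      (\<phi> \<circ> \<gamma> has_vector_derivative vector_derivative (\<phi> \<circ> \<gamma>) (at t)) (at t)"
proof -
  define Q where "Q = (\<lambda>I. \<forall>(U, \<phi>)\<in>A. C1_on {t \<in> I. \<gamma> t \<in> U} (\<phi> \<circ> \<gamma>))"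
  have path: "pathin M \<gamma>" and pw: "piecewise Q"
    using \<gamma> unfolding piecewise_C1_curve_def Q_def by blast+
  obtain S where S: "finite S"
    "\<And>t. t \<in> {0..1} - S \<Longrightarrow> \<exists>a b. 0 \<le> a \<and> a < t \<and> t < b \<and> b \<le> 1 \<and> Q {a..b}"
    using piecewise_off_finite[OF pw] by metis
  show thesis
  proof (rule that[OF S(1)])
    fix t U \<phi> assume t: "t \<in> {0..1} - S" "\<gamma> t \<in> U" and c: "(U, \<phi>) \<in> A"
    obtain a b where ab: "0 \<le> a" "a < t" "t < b" "b \<le> 1" "Q {a..b}"
      using S(2)[OF t(1)] by blast
    then have "C1_on {t \<in> {a..b}. \<gamma> t \<in> U} (\<phi> \<circ> \<gamma>)"
      using c unfolding Q_def by blast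
    then obtain D where "\<And>t. t \<in> {a<..<b} \<Longrightarrow> \<gamma> t \<in> U \<Longrightarrow> (\<phi> \<circ> \<gamma> has_vector_derivative D t) (at t)"
      using C1_piece_derivative[OF path c ab(1,4)] by blast
    then have "(\<phi> \<circ> \<gamma> has_vector_derivative D t) (at t)"
      using t(2) ab by auto
    then show "(\<phi> \<circ> \<gamma> has_vector_derivative vector_derivative (\<phi> \<circ> \<gamma>) (at t)) (at t)"
      by (metis vector_derivative_at)
  qed
qed

end

section \<open>Almost isometric charts\<close>

text \<open>
  A chart in which the metric tensor differs from a constant one by a factor of at most \<open>c\<^sup>2\<close>. The linear
  map \<open>L\<close> normalizes the constant tensor to the Euclidean one. It is kept apart from \<open>\<phi>\<close> because the
  composition of the two need not belong to the atlas.
\<close>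

locale almost_isometric_chart = riemannian_manifold M A g
  for M :: "'m topology" and A :: "('m, 'e::euclidean_space) chart set" and g +
  fixes U :: "'m set" and \<phi> :: "'m \<Rightarrow> 'e" and p :: 'm and L :: "'e \<Rightarrow> 'e" and R c :: real
  assumes chart_mem: "(U, \<phi>) \<in> A" and centre: "p \<in> U"
    and linear_L: "linear L" and bij_L: "bij L" and R_pos: "0 < R" and c_ge_1: "1 \<le> c"
    and ball_covered: "ball 0 R \<subseteq> (\<lambda>y. L (\<phi> y - \<phi> p)) ` U"
    and norm_le_metric: "y \<in> U \<Longrightarrow> norm (L (\<phi> y - \<phi> p)) < R \<Longrightarrow> norm (L v) \<le> c * sqrt (g (U, \<phi>) y v v)"
    and metric_le_norm: "y \<in> U \<Longrightarrow> norm (L (\<phi> y - \<phi> p)) < R \<Longrightarrow> sqrt (g (U, \<phi>) y v v) \<le> c * norm (L v)"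
begin

definition \<psi> :: "'m \<Rightarrow> 'e" where
  "\<psi> y = L (\<phi> y - \<phi> p)"

definition coord_ball :: "real \<Rightarrow> 'm set" where
  "coord_ball r = {y \<in> U. norm (\<psi> y) < r}"

lemma psi_centre [simp]: "\<psi> p = 0"
  by (simp add: \<psi>_def linear_0[OF linear_L])

lemma inj_psi: "inj_on \<psi> U"
proof (rule inj_onI)
  fix x y assume "x \<in> U" "y \<in> U" "\<psi> x = \<psi> y"
  then have "\<phi> x = \<phi> y"
    using bij_L unfolding \<psi>_def by (metis add_diff_cancel_right' bij_is_inj diff_add_cancel inj_eq)
  then show "x = y"
    using chart_inj[OF chart_mem] \<open>x \<in> U\<close> \<open>y \<in> U\<close> by (simp add: inj_onD)
qed

lemma psi_onto:
  assumes "norm z < r" "r \<le> R"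
  obtains y where "y \<in> coord_ball r" "\<psi> y = z"
proof -
  have "z \<in> (\<lambda>y. L (\<phi> y - \<phi> p)) ` U"
    using assms by (intro subsetD[OF ball_covered]) simp
  then show thesis
    using that assms(1) by (auto simp: coord_ball_def \<psi>_def)
qed

lemma coord_ball_subset: "coord_ball r \<subseteq> U" "coord_ball r \<subseteq> topspace M"
  using chart_subset[OF chart_mem] by (auto simp: coord_ball_def)

lemma psi_continuous: "continuous_map (subtopology M U) euclidean \<psi>"
proof -
  have "continuous_on UNIV (\<lambda>x. L (x - \<phi> p))"
    by (intro linear_continuous_on_compose[OF _ linear_L] continuous_intros)
  then have "continuous_map (subtopology M U) euclidean ((\<lambda>x. L (x - \<phi> p)) \<circ> \<phi>)"
    by (intro continuous_map_compose[OF chart_continuous[OF chart_mem]]) simp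
  then show ?thesis
    by (simp add: o_def \<psi>_def[abs_def])
qed

lemma openin_coord_ball: "openin M (coord_ball r)"
proof -
  have "openin (subtopology M U) {y \<in> topspace (subtopology M U). \<psi> y \<in> ball 0 r}"
    by (rule openin_continuous_map_preimage[OF psi_continuous]) simp
  moreover have "{y \<in> topspace (subtopology M U). \<psi> y \<in> ball 0 r} = coord_ball r"
    using chart_subset[OF chart_mem] by (auto simp: coord_ball_def)
  ultimately show ?thesis
    using chart[OF chart_mem] openin_trans_full by metis
qed

text \<open>
  Preimages of closed coordinate balls are compact, hence closed, since \<open>M\<close> is Hausdorff. Without this a
  curve could leave the chart without approaching the boundary of the coordinate ball.
\<close>

lemma closedin_closed_ball:
  assumes "r < R"
  shows "closedin M {y \<in> U. norm (\<psi> y) \<le> r}"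
proof (rule compactin_imp_closedin[OF Hausdorff])
  obtain L' where L': "linear L'" "\<And>x. L (L' x) = x" "\<And>x. L' (L x) = x"
    using linear_injective_left_inverse[OF linear_L bij_is_inj[OF bij_L]] bij_L
    by (metis bij_is_surj comp_apply id_apply surj_def)
  define h where "h = (\<lambda>z. \<phi> p + L' z)"
  have sub: "h ` cball 0 r \<subseteq> \<phi> ` U"
  proof
    fix x assume "x \<in> h ` cball 0 r"
    then obtain z where z: "norm z \<le> r" "x = h z" by auto
    then obtain y where "y \<in> U" "\<psi> y = z"
      using psi_onto[of z R] assms coord_ball_subset by (metis le_less_trans order_refl subsetD)
    then have "\<phi> y = x"
      using z L'(3)[of "\<phi> y - \<phi> p"] by (simp add: h_def \<psi>_def)
    then show "x \<in> \<phi> ` U"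
      using \<open>y \<in> U\<close> by blast
  qed
  have "compact (h ` cball 0 r)"
    unfolding h_def using linear_continuous_on[OF L'(1)[unfolded linear_conv_bounded_linear]]
    by (intro compact_continuous_image continuous_intros) auto
  then have "compactin M (inv_into U \<phi> ` h ` cball 0 r)"
    using sub by (intro image_compactin[OF _ chart_inverse_continuous[OF chart_mem]])
      (simp add: compactin_subtopology)
  moreover have "inv_into U \<phi> ` h ` cball 0 r = {y \<in> U. norm (\<psi> y) \<le> r}"
  proof (intro equalityI subsetI)
    fix y assume y: "y \<in> inv_into U \<phi> ` h ` cball 0 r"
    then obtain z where z: "z \<in> cball 0 r" "y = inv_into U \<phi> (h z)" by blast
    then have "h z \<in> \<phi> ` U" using sub by blast
    then have "y \<in> U" "\<phi> y = h z"
      using z by (simp_all add: inv_into_into f_inv_into_f)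
    then show "y \<in> {y \<in> U. norm (\<psi> y) \<le> r}"
      using z L'(2) by (simp add: \<psi>_def h_def)
  next
    fix y assume y: "y \<in> {y \<in> U. norm (\<psi> y) \<le> r}"
    then have "h (\<psi> y) = \<phi> y"
      using L'(3) by (simp add: h_def \<psi>_def)
    then have "y = inv_into U \<phi> (h (\<psi> y))"
      using y chart_inj[OF chart_mem] by simp
    then show "y \<in> inv_into U \<phi> ` h ` cball 0 r"
      using y by (intro image_eqI[of _ _ "h (\<psi> y)"] imageI) auto
  qed
  ultimately show "compactin M {y \<in> U. norm (\<psi> y) \<le> r}"
    by simp
qed

lemma increment_le_length:
  assumes \<gamma>: "piecewise_C1_curve M A \<gamma>" and ab: "0 \<le> a" "a \<le> b" "b \<le> 1" and inside: "\<gamma> ` {a..b} \<subseteq> coord_ball R"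
  shows "norm (\<psi> (\<gamma> b) - \<psi> (\<gamma> a)) \<le> c * integral {0..1} (riemannian_speed A g \<gamma>)"
proof -
  have path: "pathin M \<gamma>"
    using \<gamma> unfolding piecewise_C1_curve_def by blast
  have U: "\<gamma> t \<in> U" "norm (\<psi> (\<gamma> t)) < R" if "t \<in> {a..b}" for t
    using inside that unfolding coord_ball_def image_subset_iff by auto
  obtain S where S: "finite S"
    "\<And>t. t \<in> {0..1} - S \<Longrightarrow> \<gamma> t \<in> U \<Longrightarrow>
      (\<phi> \<circ> \<gamma> has_vector_derivative vector_derivative (\<phi> \<circ> \<gamma>) (at t)) (at t)"
    using curve_derivative_off_finite[OF \<gamma>] chart_mem by metis
  define v where "v = (\<lambda>t. vector_derivative (\<phi> \<circ> \<gamma>) (at t))"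
  have int: "riemannian_speed A g \<gamma> integrable_on {a..b}"
    by (rule integrable_subinterval_real[OF speed_integrable[OF \<gamma>]]) (use ab in auto)
  have "norm ((\<psi> \<circ> \<gamma>) b - (\<psi> \<circ> \<gamma>) a) \<le> integral {a..b} (\<lambda>t. c * riemannian_speed A g \<gamma> t)"
  proof (rule norm_increment_le_integral[OF ab(2) S(1), where h' = "\<lambda>t. L (v t)"])
    show "continuous_on {a..b} (\<psi> \<circ> \<gamma>)"
      using ab U(1) by (intro path_in_chart_continuous[OF path psi_continuous]) auto
    show "(\<lambda>t. c * riemannian_speed A g \<gamma> t) integrable_on {a..b}"
      using int by (rule integrable_on_mult_right)
    fix t assume t: "t \<in> {a<..<b} - S"
    then have tU: "\<gamma> t \<in> U" "norm (\<psi> (\<gamma> t)) < R" and t01: "t \<in> {0<..<1}" "t \<in> {0..1} - S"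
      using U[of t] ab by auto
    have v: "(\<phi> \<circ> \<gamma> has_vector_derivative v t) (at t)"
      unfolding v_def by (rule S(2)[OF t01(2) tU(1)])
    then have "((\<lambda>s. (\<phi> \<circ> \<gamma>) s - \<phi> p) has_vector_derivative v t) (at t)"
      using has_vector_derivative_diff[OF v has_vector_derivative_const] by simp
    then have "((\<lambda>s. L ((\<phi> \<circ> \<gamma>) s - \<phi> p)) has_vector_derivative L (v t)) (at t)"
      by (rule bounded_linear.has_vector_derivative[OF linear_L[unfolded linear_conv_bounded_linear]])
    then show "(\<psi> \<circ> \<gamma> has_vector_derivative L (v t)) (at t)"
      by (simp add: o_def \<psi>_def)
    show "norm (L (v t)) \<le> c * riemannian_speed A g \<gamma> t"
      unfolding speed_eq[OF path t01(1) chart_mem tU(1) v]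
      using tU by (intro norm_le_metric) (simp_all add: \<psi>_def)
  qed
  also have "\<dots> = c * integral {a..b} (riemannian_speed A g \<gamma>)"
    by simp
  also have "\<dots> \<le> c * integral {0..1} (riemannian_speed A g \<gamma>)"
    using ab c_ge_1 speed_nonneg[OF path]
    by (intro mult_left_mono integral_subinterval_le speed_integrable[OF \<gamma>]) auto
  finally show ?thesis
    by simp
qed

text \<open>
  A curve that leaves the ball of radius \<open>r\<close> crosses its boundary sphere for the first time at some
  parameter \<open>s\<close>, and the part before \<open>s\<close> stays in the chart.
\<close>

lemma exit_length:
  assumes \<gamma>: "piecewise_C1_curve M A \<gamma>" and r: "r < R" and start: "\<gamma> 0 \<in> coord_ball r"
    and exit: "\<not> \<gamma> ` {0..1} \<subseteq> coord_ball r"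
  shows "r - norm (\<psi> (\<gamma> 0)) \<le> c * integral {0..1} (riemannian_speed A g \<gamma>)"
proof -
  have path: "continuous_map (top_of_set {0..1}) M \<gamma>" and path': "pathin M \<gamma>"
    using \<gamma> unfolding piecewise_C1_curve_def pathin_def by blast+
  have range: "\<gamma> t \<in> topspace M" if "t \<in> {0..1}" for t
    using path that unfolding continuous_map by auto
  define T where "T = {t \<in> {0..1}. \<gamma> t \<in> topspace M - coord_ball r}"
  have "closedin (top_of_set {0..1}) T"
    using closedin_continuous_map_preimage[OF path, of "topspace M - coord_ball r"] openin_coord_ball
    by (simp add: T_def closedin_diff)
  then have T: "closed T" "T \<noteq> {}" "bdd_below T" "T \<subseteq> {0..1}"
    using exit range by (auto simp: T_def closedin_closed_eq intro: bdd_belowI[of _ 0])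
  define s where "s = Inf T"
  have s: "s \<in> T"
    unfolding s_def using T by (intro closed_contains_Inf) auto
  have before: "\<gamma> t \<in> coord_ball r" if "0 \<le> t" "t < s" for t
  proof -
    have "t \<notin> T"
      using that(2) T(3) cInf_lower unfolding s_def by fastforce
    then show ?thesis
      using that s T(4) range[of t] by (auto simp: T_def)
  qed
  have "0 < s"
    using s start T(4) by (cases "s = 0") (auto simp: T_def)
  define Z where "Z = {t \<in> {0..1}. \<gamma> t \<in> {y \<in> U. norm (\<psi> y) \<le> r}}"
  have "closedin (top_of_set {0..1}) Z"
    using closedin_continuous_map_preimage[OF path closedin_closed_ball[OF r]] by (simp add: Z_def)
  then have "closed Z"
    by (simp add: closedin_closed_eq)
  moreover have "{0..<s} \<subseteq> Z"
    using before s T(4) by (fastforce simp: Z_def coord_ball_def)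
  ultimately have "closure {0..<s} \<subseteq> Z"
    by (rule closure_minimal[rotated])
  then have "s \<in> Z"
    using \<open>0 < s\<close> by auto
  then have "\<gamma> s \<in> U" "norm (\<psi> (\<gamma> s)) \<le> r" "\<not> norm (\<psi> (\<gamma> s)) < r"
    using s by (auto simp: Z_def T_def coord_ball_def)
  then have sU: "\<gamma> s \<in> U" "norm (\<psi> (\<gamma> s)) = r"
    by auto
  have "\<gamma> ` {0..s} \<subseteq> coord_ball R"
  proof (rule image_subsetI)
    fix t assume "t \<in> {0..s}"
    then show "\<gamma> t \<in> coord_ball R"
      using before[of t] sU r by (cases "t = s") (auto simp: coord_ball_def)
  qed
  then have "norm (\<psi> (\<gamma> s) - \<psi> (\<gamma> 0)) \<le> c * integral {0..1} (riemannian_speed A g \<gamma>)"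
    using s T(4) by (intro increment_le_length[OF \<gamma>]) auto
  moreover have "r - norm (\<psi> (\<gamma> 0)) \<le> norm (\<psi> (\<gamma> s) - \<psi> (\<gamma> 0))"
    using norm_triangle_ineq2[of "\<psi> (\<gamma> s)" "\<psi> (\<gamma> 0)"] sU(2) by simp
  ultimately show ?thesis
    by linarith
qed

lemma length_ge:
  assumes \<gamma>: "piecewise_C1_curve M A \<gamma>" and r: "r < R" and start: "\<gamma> 0 \<in> coord_ball r"
  shows "\<gamma> 1 \<in> coord_ball r \<Longrightarrow> min (norm (\<psi> (\<gamma> 1) - \<psi> (\<gamma> 0))) (r - norm (\<psi> (\<gamma> 0)))
      \<le> c * integral {0..1} (riemannian_speed A g \<gamma>)"
    and "\<gamma> 1 \<notin> coord_ball r \<Longrightarrow> r - norm (\<psi> (\<gamma> 0)) \<le> c * integral {0..1} (riemannian_speed A g \<gamma>)"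
proof -
  show "r - norm (\<psi> (\<gamma> 0)) \<le> c * integral {0..1} (riemannian_speed A g \<gamma>)" if "\<gamma> 1 \<notin> coord_ball r"
  proof (rule exit_length[OF assms])
    show "\<not> \<gamma> ` {0..1} \<subseteq> coord_ball r"
      using that by (metis atLeastAtMost_iff image_subset_iff order_refl zero_le_one)
  qed
  show "min (norm (\<psi> (\<gamma> 1) - \<psi> (\<gamma> 0))) (r - norm (\<psi> (\<gamma> 0)))
      \<le> c * integral {0..1} (riemannian_speed A g \<gamma>)"
  proof (cases "\<gamma> ` {0..1} \<subseteq> coord_ball r")
    case True
    then have "\<gamma> ` {0..1} \<subseteq> coord_ball R"
      using r by (auto simp: coord_ball_def)
    then show ?thesis
      using increment_le_length[OF \<gamma>, of 0 1] by simp
  next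
    case False
    then show ?thesis
      using exit_length[OF assms] by simp
  qed
qed

lemma segment_curve:
  assumes x: "x \<in> coord_ball R" and y: "y \<in> coord_ball R"
  defines "\<gamma> \<equiv> \<lambda>t. inv_into U \<phi> (\<phi> x + t *\<^sub>R (\<phi> y - \<phi> x))"
  shows "piecewise_C1_curve M A \<gamma>" "\<gamma> 0 = x" "\<gamma> 1 = y"
    and "integral {0..1} (riemannian_speed A g \<gamma>) \<le> c * norm (\<psi> x - \<psi> y)"
proof -
  define \<sigma> where "\<sigma> = (\<lambda>t. \<phi> x + t *\<^sub>R (\<phi> y - \<phi> x))"
  define v where "v = \<phi> y - \<phi> x"
  have \<sigma>: "(\<sigma> has_vector_derivative v) (at t within T)" for t T
    unfolding \<sigma>_def v_def by (rule has_vector_derivative_at_within[OF has_vector_derivative_segment])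
  have \<sigma>_cont: "continuous_on T \<sigma>" for T
    unfolding \<sigma>_def by (intro continuous_intros)
  have in_ball: "\<exists>z\<in>coord_ball R. \<phi> z = \<sigma> t" if t: "t \<in> {0..1}" for t
  proof -
    have "L (\<sigma> t - \<phi> p) = L ((1 - t) *\<^sub>R (\<phi> x - \<phi> p) + t *\<^sub>R (\<phi> y - \<phi> p))"
      by (simp add: \<sigma>_def algebra_simps)
    also have "\<dots> = (1 - t) *\<^sub>R \<psi> x + t *\<^sub>R \<psi> y"
      by (simp add: \<psi>_def linear_add[OF linear_L] linear_cmul[OF linear_L])
    finally have eq: "L (\<sigma> t - \<phi> p) = (1 - t) *\<^sub>R \<psi> x + t *\<^sub>R \<psi> y" .
    have "(1 - t) *\<^sub>R \<psi> x + t *\<^sub>R \<psi> y \<in> ball 0 R"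
      using x y t convexD_alt[OF convex_ball, of "\<psi> x" 0 R "\<psi> y" t] by (simp add: coord_ball_def)
    then obtain z where z: "z \<in> coord_ball R" "\<psi> z = L (\<sigma> t - \<phi> p)"
      using psi_onto[of "L (\<sigma> t - \<phi> p)" R] eq by auto
    then have "\<phi> z = \<sigma> t"
      using bij_L unfolding \<psi>_def by (metis add_diff_cancel_right' bij_is_inj diff_add_cancel inj_eq)
    then show ?thesis using z by blast
  qed
  have \<gamma>: "\<gamma> t \<in> coord_ball R" "\<phi> (\<gamma> t) = \<sigma> t" if t: "t \<in> {0..1}" for t
  proof -
    obtain z where z: "z \<in> coord_ball R" "\<phi> z = \<sigma> t"
      using in_ball[OF t] by blast
    then have "\<gamma> t = z"
      using inv_into_f_f[OF chart_inj[OF chart_mem], of z] coord_ball_subset by (auto simp: \<gamma>_def \<sigma>_def)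
    then show "\<gamma> t \<in> coord_ball R" "\<phi> (\<gamma> t) = \<sigma> t"
      using z by auto
  qed
  have \<gamma>U: "\<gamma> t \<in> U" "norm (L (\<phi> (\<gamma> t) - \<phi> p)) < R" if "t \<in> {0..1}" for t
    using \<gamma>(1)[OF that] by (auto simp: coord_ball_def \<psi>_def)
  have path: "pathin M \<gamma>"
    unfolding pathin_def
  proof -
    have "continuous_map (top_of_set {0..1}) (top_of_set (\<phi> ` U)) \<sigma>"
      using \<sigma>_cont \<gamma>(2) \<gamma>U(1) by (auto simp: continuous_map_in_subtopology) (metis imageI)
    from continuous_map_compose[OF this chart_inverse_continuous[OF chart_mem]]
    show "continuous_map (top_of_set {0..1}) M \<gamma>"
      by (simp add: o_def \<gamma>_def \<sigma>_def)
  qed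
  have C1: "C1_on {t \<in> {0..1}. \<gamma> t \<in> V} (\<psi>' \<circ> \<gamma>)" if V: "(V, \<psi>') \<in> A" for V \<psi>'
  proof -
    define T where "T = {t \<in> {0..1}. \<gamma> t \<in> V}"
    define D where "D = (\<lambda>t. frechet_derivative (\<psi>' \<circ> inv_into U \<phi>) (at (\<sigma> t)) v)"
    have \<sigma>T: "\<sigma> t \<in> \<phi> ` (U \<inter> V)" if "t \<in> T" for t
      using \<gamma>(2)[of t] \<gamma>U(1)[of t] that by (auto simp: T_def intro!: image_eqI[of _ _ "\<gamma> t"])
    have "continuous_on T ((\<lambda>x. frechet_derivative (\<psi>' \<circ> inv_into U \<phi>) (at x) v) \<circ> \<sigma>)"
      using \<sigma>T by (intro continuous_on_compose \<sigma>_cont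
          continuous_on_subset[OF transition_C1(2)[OF chart_mem V]]) auto
    then have "continuous_on T D"
      by (simp add: D_def o_def)
    moreover have "(\<psi>' \<circ> \<gamma> has_vector_derivative D t) (at t within T)" if t: "t \<in> T" for t
    proof -
      have der: "(\<psi>' \<circ> inv_into U \<phi> has_derivative frechet_derivative (\<psi>' \<circ> inv_into U \<phi>) (at (\<sigma> t))) (at (\<sigma> t))"
        by (rule transition_C1(1)[OF chart_mem V \<sigma>T[OF t]])
      have lin: "frechet_derivative (\<psi>' \<circ> inv_into U \<phi>) (at (\<sigma> t)) \<circ> (\<lambda>s. s *\<^sub>R v) = (\<lambda>s. s *\<^sub>R D t)"
        by (simp only: o_apply fun_eq_iff D_def linear_cmul[OF has_derivative_linear[OF der]] simp_thms)
      have comp: "(\<psi>' \<circ> inv_into U \<phi>) \<circ> \<sigma> = \<psi>' \<circ> \<gamma>"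
        by (simp add: o_def \<gamma>_def \<sigma>_def)
      have "((\<psi>' \<circ> inv_into U \<phi>) \<circ> \<sigma> has_derivative
          frechet_derivative (\<psi>' \<circ> inv_into U \<phi>) (at (\<sigma> t)) \<circ> (\<lambda>s. s *\<^sub>R v)) (at t within T)"
        using \<sigma>[of t T] unfolding has_vector_derivative_def
        by (intro diff_chain_within has_derivative_at_withinI[OF der])
      then show ?thesis
        unfolding has_vector_derivative_def lin comp .
    qed
    ultimately show ?thesis
      unfolding C1_on_def T_def by blast
  qed
  show curve: "piecewise_C1_curve M A \<gamma>"
    unfolding piecewise_C1_curve_def piecewise_def
  proof (intro conjI path exI)
    show "real 0 = 0" "real 1 = 1" by simp_all
    show "\<forall>i<1. real i < real (Suc i) \<and> (\<forall>(U, \<phi>)\<in>A. C1_on {t \<in> {real i..real (Suc i)}. \<gamma> t \<in> U} (\<phi> \<circ> \<gamma>))"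
      using C1 by auto
  qed
  show "\<gamma> 0 = x" "\<gamma> 1 = y"
    using x y coord_ball_subset chart_inj[OF chart_mem] by (auto simp: \<gamma>_def subset_iff)
  have "integral {0..1} (riemannian_speed A g \<gamma>) \<le> c * norm (L v)"
  proof -
    have der: "(\<phi> \<circ> \<gamma> has_vector_derivative v) (at t)" if t: "t \<in> {0<..<1}" for t
      using \<gamma>(2) t by (intro has_vector_derivative_transform_within_open[OF \<sigma>, where S = "{0<..<1}"]) auto
    have sp: "riemannian_speed A g \<gamma> t \<le> c * norm (L v)" if t: "t \<in> {0..1} - {0, 1}" for t
    proof -
      have t': "t \<in> {0<..<1}" "t \<in> {0..1}" using t by auto
      show ?thesis
        unfolding speed_eq[OF path t'(1) chart_mem \<gamma>U(1)[OF t'(2)] der[OF t'(1)]]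
        by (rule metric_le_norm[OF \<gamma>U[OF t'(2)]])
    qed
    have "integral {0..1} (riemannian_speed A g \<gamma>)
        = integral {0..1} (\<lambda>t. if t \<in> {0, 1} then 0 else riemannian_speed A g \<gamma> t)"
      by (rule integral_spike[of "{0, 1}"]) auto
    also have "\<dots> \<le> integral {0..1} (\<lambda>t::real. c * norm (L v))"
    proof (rule integral_le)
      show "(\<lambda>t. if t \<in> {0, 1} then 0 else riemannian_speed A g \<gamma> t) integrable_on {0..1}"
        using speed_integrable[OF curve]
        by (subst integrable_spike_finite_eq[of "{0, 1}" _ _ "riemannian_speed A g \<gamma>"]) auto
      show "(if t \<in> {0, 1} then 0 else riemannian_speed A g \<gamma> t) \<le> c * norm (L v)" if "t \<in> {0..1}" for t
        using sp[of t] that c_ge_1 by auto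
    qed auto
    finally show ?thesis by simp
  qed
  moreover have "\<psi> x - \<psi> y = - L v"
    by (simp add: \<psi>_def v_def linear_diff[OF linear_L])
  ultimately show "integral {0..1} (riemannian_speed A g \<gamma>) \<le> c * norm (\<psi> x - \<psi> y)"
    by simp
qed

lemma dist_le:
  assumes "x \<in> coord_ball R" "y \<in> coord_ball R"
  shows "riemannian_dist M A g x y \<le> c * norm (\<psi> x - \<psi> y)"
proof -
  let ?\<gamma> = "\<lambda>t. inv_into U \<phi> (\<phi> x + t *\<^sub>R (\<phi> y - \<phi> x))"
  have "riemannian_dist M A g x y \<le> integral {0..1} (riemannian_speed A g ?\<gamma>)"
    unfolding riemannian_dist_def
  proof (rule cINF_lower)
    show "bdd_below ((\<lambda>\<gamma>. integral {0..1} (riemannian_speed A g \<gamma>)) `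
        {\<gamma>. piecewise_C1_curve M A \<gamma> \<and> \<gamma> 0 = x \<and> \<gamma> 1 = y})"
      using speed_nonneg
      by (intro bdd_belowI2[of _ 0] integral_nonneg_total) (auto simp: piecewise_C1_curve_def)
  qed (use segment_curve(1-3)[OF assms] in simp)
  then show ?thesis
    using segment_curve(4)[OF assms] by linarith
qed

text \<open>
  Two points of the ball of radius \<open>R / 4\<close> are at coordinate distance less than \<open>R / 2\<close>, and a curve that
  leaves the ball of radius \<open>3 R / 4\<close> has at least this length, up to the factor \<open>c\<close>.
\<close>

lemma norm_le_dist:
  assumes x: "x \<in> coord_ball (R / 4)" and y: "y \<in> coord_ball (R / 4)"
  shows "norm (\<psi> x - \<psi> y) \<le> c * riemannian_dist M A g x y"
proof -
  have "norm (\<psi> x - \<psi> y) / c \<le> riemannian_dist M A g x y"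
    unfolding riemannian_dist_def
  proof (rule cINF_greatest)
    have "x \<in> coord_ball R" "y \<in> coord_ball R"
      using x y R_pos by (auto simp: coord_ball_def)
    then show "{\<gamma>. piecewise_C1_curve M A \<gamma> \<and> \<gamma> 0 = x \<and> \<gamma> 1 = y} \<noteq> {}"
      using segment_curve(1-3) by blast
    fix \<gamma> assume "\<gamma> \<in> {\<gamma>. piecewise_C1_curve M A \<gamma> \<and> \<gamma> 0 = x \<and> \<gamma> 1 = y}"
    then have \<gamma>: "piecewise_C1_curve M A \<gamma>" "\<gamma> 0 = x" "\<gamma> 1 = y" by auto
    have "\<gamma> 0 \<in> coord_ball (3 * R / 4)" "\<gamma> 1 \<in> coord_ball (3 * R / 4)"
      using x y R_pos \<gamma> by (auto simp: coord_ball_def)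
    then have "min (norm (\<psi> y - \<psi> x)) (3 * R / 4 - norm (\<psi> x)) \<le> c * integral {0..1} (riemannian_speed A g \<gamma>)"
      using length_ge(1)[OF \<gamma>(1), of "3 * R / 4"] R_pos \<gamma> by simp
    moreover have "norm (\<psi> y - \<psi> x) \<le> 3 * R / 4 - norm (\<psi> x)"
      using norm_triangle_ineq4[of "\<psi> y" "\<psi> x"] x y by (simp add: coord_ball_def)
    ultimately show "norm (\<psi> x - \<psi> y) / c \<le> integral {0..1} (riemannian_speed A g \<gamma>)"
      using c_ge_1 by (simp add: norm_minus_commute pos_divide_le_eq mult.commute)
  qed
  then show ?thesis
    using c_ge_1 by (simp add: pos_divide_le_eq mult.commute)
qed

text \<open>
  If no curve joins \<open>p\<close> to \<open>y\<close>, their distance is the infimum of the empty set, which is one fixed real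
  number. As soon as it is positive it serves as a bound as well.
\<close>

lemma far_points:
  obtains \<kappa> where "0 < \<kappa>"
    "\<And>y. y \<notin> coord_ball (R / 4) \<Longrightarrow> 0 < riemannian_dist M A g p y \<Longrightarrow> \<kappa> \<le> riemannian_dist M A g p y"
proof -
  define \<kappa> where "\<kappa> = (if 0 < Inf ({} :: real set) then min (R / (4 * c)) (Inf {}) else R / (4 * c))"
  show thesis
  proof (rule that)
    have "0 < R / (4 * c)" using R_pos c_ge_1 by simp
    then show "0 < \<kappa>" by (simp add: \<kappa>_def)
    fix y assume y: "y \<notin> coord_ball (R / 4)" and pos: "0 < riemannian_dist M A g p y"
    let ?C = "{\<gamma>. piecewise_C1_curve M A \<gamma> \<and> \<gamma> 0 = p \<and> \<gamma> 1 = y}"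
    show "\<kappa> \<le> riemannian_dist M A g p y"
    proof (cases "?C = {}")
      case True
      then have "riemannian_dist M A g p y = Inf {}"
        unfolding riemannian_dist_def True by simp
      then show ?thesis
        using pos by (simp add: \<kappa>_def)
    next
      case False
      have "R / (4 * c) \<le> riemannian_dist M A g p y"
        unfolding riemannian_dist_def
      proof (rule cINF_greatest[OF False])
        fix \<gamma> assume "\<gamma> \<in> ?C"
        then have \<gamma>: "piecewise_C1_curve M A \<gamma>" "\<gamma> 0 = p" "\<gamma> 1 = y" by auto
        have "\<gamma> 0 \<in> coord_ball (R / 4)"
          using \<gamma>(2) centre R_pos by (simp add: coord_ball_def)
        then have "R / 4 - norm (\<psi> p) \<le> c * integral {0..1} (riemannian_speed A g \<gamma>)"
          using length_ge(2)[OF \<gamma>(1), of "R / 4"] R_pos \<gamma> y by simp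
        then show "R / (4 * c) \<le> integral {0..1} (riemannian_speed A g \<gamma>)"
          using c_ge_1 by (simp add: field_simps)
      qed
      then show ?thesis
        by (auto simp: \<kappa>_def)
    qed
  qed
qed

end

text \<open>
  The metric tensor is continuous, so its coefficients in an orthonormal basis at \<open>p\<close> stay close to the
  identity matrix near \<open>p\<close>.
\<close>

lemma (in riemannian_manifold) almost_isometric_chart_exists:
  assumes p: "p \<in> topspace M" and c: "1 < c"
  obtains U \<phi> L R where "almost_isometric_chart M A g U \<phi> p L R c"
proof -
  obtain U \<phi> where chart_mem: "(U, \<phi>) \<in> A" "p \<in> U"
    using chart_at[OF p] by blast
  have bil: "bilinear (g (U, \<phi>) y)" if "y \<in> U" for y
    using metric_bilinear chart_mem(1) that by blast
  obtain L :: "'e \<Rightarrow> 'e" where L: "linear L" "bij L" "\<And>u. g (U, \<phi>) p u u = (norm (L u))\<^sup>2"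
    using positive_form_eq_norm_linear[OF bil[OF chart_mem(2)]]
      metric_sym[OF chart_mem] metric_pos[OF chart_mem] by metis
  obtain L' where L': "linear L'" "\<And>x. L (L' x) = x" "\<And>x. L' (L x) = x"
    using linear_injective_left_inverse[OF L(1) bij_is_inj[OF L(2)]] L(2)
    by (metis bij_is_surj comp_apply id_apply surj_def)
  define B where "B = (\<lambda>y a b. g (U, \<phi>) y (L' a) (L' b))"
  have B_expand: "g (U, \<phi>) y u u = (\<Sum>i\<in>Basis. \<Sum>j\<in>Basis. (L u \<bullet> i) * (L u \<bullet> j) * B y i j)"
    if "y \<in> U" for y u
  proof -
    have "bilinear (B y)"
      using bil[OF that] linear_compose[OF L'(1)] unfolding bilinear_def B_def o_def by auto
    from bilinear_expand[OF this, of "L u" "L u"] show ?thesis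
      by (simp add: B_def L'(3))
  qed
  define n where "n = real DIM('e)"
  \<comment> \<open>the double sum over the basis has \<open>n\<^sup>2\<close> terms. A relative error of \<open>1
    - 1 / c\<^sup>2\<close> is allowed, because \<open>2 - 1 / c\<^sup>2 \<le> c\<^sup>2\<close>.\<close>
  define \<eta> where "\<eta> = (1 - 1 / c\<^sup>2) / n\<^sup>2"
  have n: "0 < n"
    by (simp add: n_def)
  have c2: "1 < c\<^sup>2"
    using c by (simp add: one_less_power)
  have "0 < 1 - 1 / c\<^sup>2"
    using c2 by (simp add: divide_less_eq)
  then have \<eta>: "0 < \<eta>" "n\<^sup>2 * \<eta> = 1 - 1 / c\<^sup>2"
    using n by (simp_all add: \<eta>_def)
  have "\<forall>\<^sub>F x in at (\<phi> p). \<forall>i\<in>Basis. \<forall>j\<in>Basis. \<bar>B (inv_into U \<phi> x) i j - B p i j\<bar> < \<eta>"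
  proof (intro eventually_ball_finite ballI finite_Basis)
    fix i j :: 'e
    have "isCont (\<lambda>x. B (inv_into U \<phi> x) i j) (\<phi> p)"
      using metric_coefficient_continuous[OF chart_mem(1)] chart[OF chart_mem(1)] chart_mem(2)
      unfolding B_def by (simp add: continuous_on_eq_continuous_at)
    then have "((\<lambda>x. B (inv_into U \<phi> x) i j) \<longlongrightarrow> B p i j) (at (\<phi> p))"
      using inv_into_f_f[OF chart_inj[OF chart_mem(1)] chart_mem(2)] by (simp add: isCont_def)
    from tendstoD[OF this \<eta>(1)] show "\<forall>\<^sub>F x in at (\<phi> p). \<bar>B (inv_into U \<phi> x) i j - B p i j\<bar> < \<eta>"
      by (simp add: dist_real_def)
  qed
  then obtain \<delta> where \<delta>: "0 < \<delta>" "\<And>x i j. x \<noteq> \<phi> p \<Longrightarrow> dist x (\<phi> p) < \<delta> \<Longrightarrow> i \<in> Basis \<Longrightarrow> j \<in> Basis \<Longrightarrow>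
      \<bar>B (inv_into U \<phi> x) i j - B p i j\<bar> < \<eta>"
    unfolding eventually_at by blast
  have near: "\<bar>B y i j - B p i j\<bar> \<le> \<eta>"
    if "y \<in> U" "dist (\<phi> y) (\<phi> p) < \<delta>" "i \<in> Basis" "j \<in> Basis" for y i j
  proof (cases "y = p")
    case False
    then have "\<phi> y \<noteq> \<phi> p"
      using chart_inj[OF chart_mem(1)] that(1) chart_mem(2) by (auto dest: inj_onD)
    then show ?thesis
      using \<delta>(2)[of "\<phi> y" i j] inv_into_f_f[OF chart_inj[OF chart_mem(1)] that(1)] that by simp
  qed (use \<eta> in simp)
  have quad: "\<bar>g (U, \<phi>) y u u - (norm (L u))\<^sup>2\<bar> \<le> (1 - 1 / c\<^sup>2) * (norm (L u))\<^sup>2"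
    if y: "y \<in> U" "dist (\<phi> y) (\<phi> p) < \<delta>" for y u
  proof -
    have "g (U, \<phi>) y u u - (norm (L u))\<^sup>2 =
        (\<Sum>i\<in>Basis. \<Sum>j\<in>Basis. (L u \<bullet> i) * (L u \<bullet> j) * (B y i j - B p i j))"
      unfolding L(3)[symmetric] B_expand[OF y(1)] B_expand[OF chart_mem(2)]
      by (simp add: right_diff_distrib sum_subtractf)
    also have "\<bar>\<dots>\<bar> \<le> (\<Sum>i\<in>Basis. \<Sum>j\<in>Basis. \<bar>(L u \<bullet> i) * (L u \<bullet> j) * (B y i j - B p i j)\<bar>)"
      by (rule order_trans[OF sum_abs]) (intro sum_mono sum_abs)
    also have "\<dots> \<le> (\<Sum>i\<in>(Basis::'e set). \<Sum>j\<in>(Basis::'e set). norm (L u) * norm (L u) * \<eta>)"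
      unfolding abs_mult by (intro sum_mono mult_mono near[OF y] Basis_le_norm) auto
    also have "\<dots> = n\<^sup>2 * \<eta> * (norm (L u))\<^sup>2"
      by (simp add: n_def power2_eq_square)
    finally show ?thesis
      by (simp add: \<eta>(2))
  qed
  have "bounded_linear L'"
    using L'(1) by (simp add: linear_conv_bounded_linear)
  then obtain b where b: "0 < b" "\<And>z. norm (L' z) \<le> norm z * b"
    using bounded_linear.pos_bounded by blast
  have "open (\<phi> ` U)" "\<phi> p \<in> \<phi> ` U"
    using chart[OF chart_mem(1)] chart_mem(2) by auto
  then obtain r where r: "0 < r" "ball (\<phi> p) r \<subseteq> \<phi> ` U"
    using openE by blast
  define R where "R = min r \<delta> / b"
  have R: "0 < R" using r \<delta>(1) b(1) by (simp add: R_def)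
  have small: "norm (L' z) < min r \<delta>" if "norm z < R" for z
  proof -
    have "norm z * b < R * b"
      using that b(1) by (rule mult_strict_right_mono)
    then show ?thesis
      using b(1) b(2)[of z] by (simp add: R_def)
  qed
  have close: "dist (\<phi> y) (\<phi> p) < \<delta>" if "norm (L (\<phi> y - \<phi> p)) < R" for y
    using small[OF that] by (simp add: L'(3) dist_norm)
  have "almost_isometric_chart M A g U \<phi> p L R c"
  proof
    show "ball 0 R \<subseteq> (\<lambda>y. L (\<phi> y - \<phi> p)) ` U"
    proof
      fix z :: 'e assume "z \<in> ball 0 R"
      then have "\<phi> p + L' z \<in> ball (\<phi> p) r"
        using small[of z] by (simp add: dist_norm)
      then obtain y where "y \<in> U" "\<phi> y = \<phi> p + L' z"
        using r(2) by (metis imageE subsetD)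
      then show "z \<in> (\<lambda>y. L (\<phi> y - \<phi> p)) ` U"
        by (intro image_eqI[of _ _ y]) (simp_all add: L'(2))
    qed
    fix y v assume y: "y \<in> U" "norm (L (\<phi> y - \<phi> p)) < R"
    note q = quad[OF y(1) close[OF y(2)], of v]
    have "(norm (L v))\<^sup>2 / c\<^sup>2 \<le> g (U, \<phi>) y v v"
      using q by (simp add: left_diff_distrib)
    then have "sqrt ((norm (L v))\<^sup>2 / c\<^sup>2) \<le> sqrt (g (U, \<phi>) y v v)"
      by (rule real_sqrt_le_mono)
    then show "norm (L v) \<le> c * sqrt (g (U, \<phi>) y v v)"
      using c by (simp add: real_sqrt_divide pos_divide_le_eq mult.commute)
    have "2 - 1 / c\<^sup>2 \<le> c\<^sup>2"
    proof -
      have "0 \<le> (c - 1 / c)\<^sup>2" by simp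
      also have "\<dots> = c\<^sup>2 - 2 + 1 / c\<^sup>2"
        using c by (simp add: power2_diff power_divide)
      finally show ?thesis by simp
    qed
    then have "(2 - 1 / c\<^sup>2) * (norm (L v))\<^sup>2 \<le> c\<^sup>2 * (norm (L v))\<^sup>2"
      by (rule mult_right_mono) simp
    then have "g (U, \<phi>) y v v \<le> (c * norm (L v))\<^sup>2"
      using q by (simp add: left_diff_distrib power_mult_distrib)
    then show "sqrt (g (U, \<phi>) y v v) \<le> c * norm (L v)"
      using c by (intro real_le_lsqrt) auto
  qed (use chart_mem L(2) R c in \<open>auto simp: linear_add[OF L(1)] linear_cmul[OF L(1)]\<close>)
  then show thesis
    using that by blast
qed

section \<open>Cone angles of surfaces\<close>

lemma le_of_forall_scaled_le:
  fixes a b K :: real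
  assumes "\<And>c. 1 < c \<Longrightarrow> a \<le> (K * c)\<^sup>2 * b"
  shows "a \<le> K\<^sup>2 * b"
proof (rule tendsto_lowerbound)
  have "((\<lambda>c. (K * c)\<^sup>2 * b) \<longlongrightarrow> (K * 1)\<^sup>2 * b) (at_right 1)"
    by (intro tendsto_intros)
  then show "((\<lambda>c. (K * c)\<^sup>2 * b) \<longlongrightarrow> K\<^sup>2 * b) (at_right 1)"
    by simp
  show "\<forall>\<^sub>F c in at_right 1. a \<le> (K * c)\<^sup>2 * b"
    using assms by (auto simp: eventually_at_right_field intro!: exI[of _ 2])
qed simp

text \<open>
  The map \<open>F\<close> leads from cone coordinates to the chart at the image \<open>p\<close> of \<open>x\<close>, and \<open>G\<close> leads back. The
  radii \<open>s\<close> and \<open>\<rho>\<close> are so small that the Lipschitz estimates keep the images inside the chart and inside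
  the cone neighbourhood.
\<close>

lemma cone_angle_bounds_scaled:
  fixes M :: "'m topology" and A :: "('m, 'e::euclidean_space) chart set"
  assumes X: "Metric_space X d" and M: "riemannian_manifold M A g"
    and f: "bi_lipschitz_homeomorphism K X d (topspace M) (riemannian_dist M A g) f"
    and angle: "has_cone_angle X d x \<alpha>" and c: "1 < c"
  shows "2 * pi \<le> (K * c)\<^sup>2 * \<alpha>" "\<alpha> \<le> (K * c)\<^sup>2 * (2 * pi)"
proof -
  interpret X: Metric_space X d by (rule X)
  interpret riemannian_manifold M A g by (rule M)
  define e where "e = riemannian_dist M A g"
  obtain N r h where \<alpha>: "0 < \<alpha>" and N: "openin X.mtopology N" "x \<in> N" and r: "0 < r"
    and h: "bij_betw h N (ball 0 r)" "h x = 0"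
    and d_cone: "\<And>y z. y \<in> N \<Longrightarrow> z \<in> N \<Longrightarrow> d y z = cone_dist \<alpha> (h y) (h z)"
    using angle unfolding has_cone_angle_def by blast
  interpret cone: conical \<alpha> "cone_dist \<alpha>"
    by (rule conical_cone_dist[OF \<alpha>])
  have NX: "N \<subseteq> X"
    using N(1) openin_subset by force
  obtain \<delta> where \<delta>: "0 < \<delta>" "X.mball x \<delta> \<subseteq> N"
    using N X.openin_mtopology by blast
  have K: "1 \<le> K" and bij: "bij_betw f X (topspace M)"
    and e_le: "\<And>y z. y \<in> X \<Longrightarrow> z \<in> X \<Longrightarrow> e (f y) (f z) \<le> K * d y z"
    and d_le_inv: "\<And>a b. a \<in> topspace M \<Longrightarrow> b \<in> topspace M \<Longrightarrow>
        d (inv_into X f a) (inv_into X f b) \<le> K * e a b"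
    using f unfolding bi_lipschitz_homeomorphism_def lipschitz_map_def e_def by blast+
  define h' where "h' = inv_into N h"
  define f' where "f' = inv_into X f"
  have f': "f' a \<in> X" "f (f' a) = a" if "a \<in> topspace M" for a
    using bij that by (auto simp: f'_def bij_betw_def inv_into_into f_inv_into_f)
  have f'f: "f' (f y) = y" "f y \<in> topspace M" if "y \<in> X" for y
    using bij that by (auto simp: f'_def bij_betw_def)
  have d_le: "d y z \<le> K * e (f y) (f z)" if "y \<in> X" "z \<in> X" for y z
    using d_le_inv[of "f y" "f z"] f'f that by (simp add: f'_def)
  have h': "h' z \<in> N" "h (h' z) = z" if "cmod z < r" for z
  proof -
    have "z \<in> h ` N"
      using h(1) that by (simp add: bij_betw_def)
    then show "h' z \<in> N" "h (h' z) = z"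
      by (simp_all add: h'_def inv_into_into f_inv_into_f)
  qed
  have h'h: "h' (h y) = y" if "y \<in> N" for y
    using h(1) that by (simp add: h'_def bij_betw_def)
  have xX: "x \<in> X" using N NX by blast
  define p where "p = f x"
  obtain U \<phi> L R where chart: "almost_isometric_chart M A g U \<phi> p L R c"
    using almost_isometric_chart_exists[of p c] f'f(2)[OF xX] c unfolding p_def by blast
  interpret almost_isometric_chart M A g U \<phi> p L R c by (rule chart)
  define k where "k = K * c"
  have k: "0 < k" "c * K = k"
    using K c by (simp_all add: k_def)
  define V where "V = coord_ball (R / 4)"
  have VM: "V \<subseteq> topspace M" "V \<subseteq> U" "V \<subseteq> coord_ball R"
    unfolding V_def using coord_ball_subset R_pos by (blast, blast, auto simp: coord_ball_def)
  have pV: "p \<in> V"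
    using centre R_pos by (simp add: V_def coord_ball_def)
  have e_norm: "e a b \<le> c * dist (\<psi> a) (\<psi> b)" "dist (\<psi> a) (\<psi> b) \<le> c * e a b" if "a \<in> V" "b \<in> V" for a b
    using dist_le[of a b] norm_le_dist[of a b] that VM(3) by (auto simp: dist_norm e_def V_def)
  define \<psi>' where "\<psi>' = inv_into U \<psi>"
  have \<psi>': "\<psi>' z \<in> V" "\<psi> (\<psi>' z) = z" if z: "norm z < R / 4" for z
  proof -
    obtain y where "y \<in> V" "\<psi> y = z"
      using psi_onto[OF z] R_pos by (auto simp: V_def)
    moreover from this have "\<psi>' z = y"
      using inv_into_f_f[OF inj_psi] VM(2) by (auto simp: \<psi>'_def)
    ultimately show "\<psi>' z \<in> V" "\<psi> (\<psi>' z) = z" by auto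
  qed
  have \<psi>'_0: "\<psi>' 0 = p"
    using inv_into_f_f[OF inj_psi centre] by (simp add: \<psi>'_def)
  obtain \<kappa> where \<kappa>: "0 < \<kappa>" "\<And>y. y \<notin> V \<Longrightarrow> 0 < e p y \<Longrightarrow> \<kappa> \<le> e p y"
    using far_points unfolding V_def e_def by blast

  define G where "G = (\<lambda>z. h (f' (\<psi>' z)))"
  define \<rho> where "\<rho> = min (R / 4) (\<delta> / k)"
  have \<rho>: "0 < \<rho>" "\<rho> \<le> R / 4" "k * \<rho> \<le> \<delta>"
    using R_pos \<delta>(1) k(1) by (auto simp: \<rho>_def min_def field_simps)
  have G_in: "f' (\<psi>' z) \<in> N" "\<psi>' z \<in> V" "\<psi>' z \<in> topspace M" "\<psi> (\<psi>' z) = z" if "norm z < \<rho>" for z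
  proof -
    show V: "\<psi>' z \<in> V" "\<psi>' z \<in> topspace M" "\<psi> (\<psi>' z) = z"
      using \<psi>'[of z] that \<rho> VM by auto
    have "d x (f' (\<psi>' z)) \<le> K * e p (\<psi>' z)"
      using d_le[OF xX f'(1)[OF V(2)]] f'(2)[OF V(2)] by (simp add: p_def)
    also have "\<dots> \<le> K * (c * norm z)"
      using e_norm(1)[OF pV V(1)] K V(3) by (intro mult_left_mono) auto
    also have "\<dots> < k * \<rho>"
      using mult_strict_left_mono[OF that k(1)] by (simp add: k_def mult.assoc)
    finally have "f' (\<psi>' z) \<in> X.mball x \<delta>"
      using xX f'(1)[OF V(2)] \<rho>(3) by simp
    then show "f' (\<psi>' z) \<in> N"
      using \<delta>(2) by blast
  qed

  define F where "F = (\<lambda>z. \<psi> (f (h' z)))"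
  define s where "s = min r (\<kappa> / K)"
  have s: "0 < s" "s \<le> r" "K * s \<le> \<kappa>"
    using r \<kappa>(1) K by (auto simp: s_def min_def field_simps)
  have F_in: "h' z \<in> N" "h' z \<in> X" "h (h' z) = z" "f (h' z) \<in> V" if "cmod z < s" for z
  proof -
    show hz: "h' z \<in> N" "h' z \<in> X" "h (h' z) = z"
      using h'[of z] that s NX by auto
    show "f (h' z) \<in> V"
    proof (rule ccontr)
      \<comment> \<open>the lower Lipschitz bound makes the distance from \<open>p\<close> positive, so it is at
        least \<open>\<kappa>\<close>. The upper bound makes it smaller.\<close>
      assume nV: "f (h' z) \<notin> V"
      then have "h' z \<noteq> x"
        using pV by (auto simp: p_def)
      then have "0 < d x (h' z)"
        using xX hz(2) by (metis X.mdist_pos_less)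
      also have "\<dots> \<le> K * e p (f (h' z))"
        using d_le[OF xX hz(2)] by (simp add: p_def)
      finally have "\<kappa> \<le> e p (f (h' z))"
        using \<kappa>(2)[OF nV] K by (simp add: zero_less_mult_iff)
      also have "\<dots> \<le> K * d x (h' z)"
        using e_le[OF xX hz(2)] by (simp add: p_def)
      also have "\<dots> = K * cone_dist \<alpha> 0 z"
        using d_cone[OF N(2) hz(1)] by (simp add: h(2) hz(3))
      also have "\<dots> \<le> K * cmod z"
        using cone.radial_le[of 0 "cmod z" "Arg z"] rcis_cmod_Arg[of z] K
        by (intro mult_left_mono) (auto simp: rcis_def)
      also have "\<dots> < K * s"
        using that K by simp
      finally show False
        using s(3) by simp
    qed
  qed

  have *: "2 * pi \<le> k\<^sup>2 * \<alpha> \<and> \<alpha> \<le> k\<^sup>2 * (2 * pi)"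
  proof (rule cone_angle_bounds[OF \<alpha> k(1) s(1) \<rho>(1), where F = F and G = G])
    have "h' 0 = x"
      using h'h[OF N(2)] by (simp add: h(2))
    then show "F 0 = 0"
      by (simp add: F_def flip: p_def)
    show "G 0 = 0"
      using f'f(1)[OF xX] by (simp add: G_def \<psi>'_0 p_def h(2))
  next
    fix y z :: complex assume yz: "cmod y < s" "cmod z < s"
    note Y = F_in[OF yz(1)] and Z = F_in[OF yz(2)]
    have cone: "cone_dist \<alpha> y z = d (h' y) (h' z)"
      using d_cone[OF Y(1) Z(1)] Y(3) Z(3) by simp
    have "dist (F y) (F z) \<le> c * e (f (h' y)) (f (h' z))"
      unfolding F_def by (rule e_norm(2)[OF Y(4) Z(4)])
    also have "\<dots> \<le> c * (K * d (h' y) (h' z))"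
      using e_le[OF Y(2) Z(2)] c by (intro mult_left_mono) auto
    finally show "dist (F y) (F z) \<le> k * cone_dist \<alpha> y z"
      by (simp add: cone k(2) flip: mult.assoc)
    have "cone_dist \<alpha> y z \<le> K * e (f (h' y)) (f (h' z))"
      using d_le[OF Y(2) Z(2)] by (simp add: cone)
    also have "\<dots> \<le> K * (c * dist (F y) (F z))"
      unfolding F_def using e_norm(1)[OF Y(4) Z(4)] K by (intro mult_left_mono) auto
    finally show "cone_dist \<alpha> y z \<le> k * dist (F y) (F z)"
      by (simp add: k_def mult.assoc)
  next
    fix y z :: 'e assume yz: "norm y < \<rho>" "norm z < \<rho>"
    note Y = G_in[OF yz(1)] and Z = G_in[OF yz(2)]
    have cone: "cone_dist \<alpha> (G y) (G z) = d (f' (\<psi>' y)) (f' (\<psi>' z))"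
      using d_cone[OF Y(1) Z(1)] by (simp add: G_def)
    have "cone_dist \<alpha> (G y) (G z) \<le> K * e (\<psi>' y) (\<psi>' z)"
      using d_le_inv[OF Y(3) Z(3)] by (simp add: cone f'_def)
    also have "\<dots> \<le> K * (c * dist y z)"
      using e_norm(1)[OF Y(2) Z(2)] Y(4) Z(4) K by (intro mult_left_mono) auto
    finally show "cone_dist \<alpha> (G y) (G z) \<le> k * dist y z"
      by (simp add: k_def mult.assoc)
    have "dist y z \<le> c * e (\<psi>' y) (\<psi>' z)"
      using e_norm(2)[OF Y(2) Z(2)] Y(4) Z(4) by simp
    also have "\<dots> \<le> c * (K * d (f' (\<psi>' y)) (f' (\<psi>' z)))"
      using e_le[OF f'(1)[OF Y(3)] f'(1)[OF Z(3)]] f'(2)[OF Y(3)] f'(2)[OF Z(3)] c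
      by (intro mult_left_mono) auto
    finally show "dist y z \<le> k * cone_dist \<alpha> (G y) (G z)"
      by (simp add: cone k(2) flip: mult.assoc)
  next
    fix z :: 'e assume "norm z < \<rho>"
    note Z = G_in[OF this]
    show "F (G z) = z"
      using h'h[OF Z(1)] f'(2)[OF Z(3)] Z(4) by (simp add: F_def G_def)
  qed
  then show "2 * pi \<le> (K * c)\<^sup>2 * \<alpha>" "\<alpha> \<le> (K * c)\<^sup>2 * (2 * pi)"
    by (simp_all add: k_def)
qed

theorem proposition4:
  fixes C :: "'v set set" and d :: "('v \<Rightarrow> real) \<Rightarrow> ('v \<Rightarrow> real) \<Rightarrow> real"
    and M :: "'m topology" and A :: "('m, 'e::euclidean_space) chart set"
    and g :: "('m, 'e) chart \<Rightarrow> 'm \<Rightarrow> 'e \<Rightarrow> 'e \<Rightarrow> real"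
    and K :: real and f :: "('v \<Rightarrow> real) \<Rightarrow> 'm"
  assumes "polyhedral_metric_surface C d"
    and "riemannian_manifold M A g"
    and "bi_lipschitz_homeomorphism K (realization C) d (topspace M) (riemannian_dist M A g) f"
    and "{v} \<in> C"
    and "has_cone_angle (realization C) d (vertex_point v) \<alpha>"
  shows "2 * pi / K\<^sup>2 \<le> \<alpha> \<and> \<alpha> \<le> 2 * pi * K\<^sup>2"
proof -
  have X: "Metric_space (realization C) d"
    using assms(1) unfolding polyhedral_metric_surface_def length_metric_def by blast
  have "2 * pi \<le> K\<^sup>2 * \<alpha>" "\<alpha> \<le> K\<^sup>2 * (2 * pi)"
    by (rule le_of_forall_scaled_le; use cone_angle_bounds_scaled[OF X assms(2,3,5)] in blast)+
  moreover have "0 < K\<^sup>2"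
    using assms(3) by (simp add: bi_lipschitz_homeomorphism_def)
  ultimately show ?thesis
    by (simp add: pos_divide_le_eq mult.commute)
qed

end
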